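(* Let $k \geq 2$ be an integer. For each integer pair $1\leq i<j\leq k$, let $d_{i,j}=d_{j,i}$ be constants in $[0,1]$. Let $G$ be a multipartite graph with vertex partition $V_1\cup V_2\cup\cdots\cup V_k$ such that for each pair $1\leq i<j\leq k$ the edge density between $V_i$ and $V_j$ is $d_{i,j}$, and let $|V_i|=n_i$. Then the number of independent transversals in $G$ is at most \[ \min_{H\in\mathcal{H}}\left\{ n_1\cdots n_k \prod_{F\in H}\prod_{(i,j)\in E(F)}\sqrt{1-d_{i,j}} + o(n_1\cdots n_k)\right\}, \] where $\mathcal{H}$ is the set of all odd cycle decompositions of $K_k$. Furthermore, this bound is asymptotically sharp: there exist such multipartite graphs with these densities whose number of independent transversals equals this bound up to an $o(n_1\cdots n_k)$ error.
   Context: The edge density between $V_i$ and $V_j$ is $e(V_i,V_j)/(|V_i||V_j|)$. An independent transversal is an independent set of $G$ containing exactly one vertex of each $V_i$. The $o(n_1\cdots n_k)$ term is with respect to all $n_i\to\infty$ ($k$ and the $d_{i,j}$ fixed). An odd cycle decomposition of $K_k$ (on vertex set $\{1,\dots,k\}$) is a collection of vertex-disjoint graphs $F_1,\dots,F_\ell$ whose vertex sets together cover $\{1,\dots,k\}$, where each $F_i$ is either an odd cycle in $K_k$ (of length at least $3$), a double edge (two vertices $i,j$ joined by two parallel edges, so that the pair $(i,j)$ appears twice in $E(F)$), or an isolated vertex (contributing no edges). The inner product runs over edges counted with multiplicity, so a double edge on $\{i,j\}$ contributes the factor $1-d_{i,j}$.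
   Formalization: "Edge density is d_{i,j}" is read as: the edge count is d_{i,j} n_i n_j up to integer rounding (error below 1). Exact density is impossible for irrational d_{i,j}, so sharpness fails literally there; when all d_{i,j} n_i n_j are integers it means exact density. *)

theory Defs
  imports Complex_Main "HOL-Library.Multiset" "HOL-Library.Disjoint_Sets" "HOL-Library.Landau_Symbols"
begin

subsection \<open>Multipartite graphs\<close>

text \<open>The parts are \<open>V 1, \<dots>, V k\<close>; values of \<open>V\<close> outside \<open>{1..k}\<close> are irrelevant.
  An edge is a two-element set of vertices.\<close>

definition multipartite_graph :: "nat \<Rightarrow> (nat \<Rightarrow> 'a set) \<Rightarrow> 'a set set \<Rightarrow> bool" where
  "multipartite_graph k V E \<longleftrightarrow>
     (\<forall>i\<in>{1..k}. finite (V i)) \<and>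
     disjoint_family_on V {1..k} \<and>
     (\<forall>e\<in>E. \<exists>i\<in>{1..k}. \<exists>j\<in>{1..k}. i \<noteq> j \<and> (\<exists>u\<in>V i. \<exists>v\<in>V j. e = {u, v}))"

definition edges_between :: "'a set set \<Rightarrow> 'a set \<Rightarrow> 'a set \<Rightarrow> 'a set set" where
  "edges_between E A B = {e \<in> E. \<exists>u\<in>A. \<exists>v\<in>B. e = {u, v}}"

definition edge_density :: "'a set set \<Rightarrow> 'a set \<Rightarrow> 'a set \<Rightarrow> real" where
  "edge_density E A B = real (card (edges_between E A B)) / (real (card A) * real (card B))"

text \<open>A density is always a rational number with denominator \<open>n\<^sub>i * n\<^sub>j\<close>, where
  \<open>n\<^sub>i = card (V i)\<close>, whereas the prescribed constant \<open>d i j\<close> may be any real in \<open>[0,1]\<close>.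
  So the number of edges is required to be \<open>d i j * n\<^sub>i * n\<^sub>j\<close> up to integer rounding.
  Graphs with density exactly \<open>d i j\<close> are included, and if \<open>d i j * n\<^sub>i * n\<^sub>j\<close> is an
  integer then nothing else is (\<open>has_edge_densities_exact\<close> below). For an empty part the
  condition fails, since then the right-hand side is \<open>1 / 0 = 0\<close>.\<close>

definition has_edge_densities ::
    "nat \<Rightarrow> (nat \<Rightarrow> nat \<Rightarrow> real) \<Rightarrow> (nat \<Rightarrow> 'a set) \<Rightarrow> 'a set set \<Rightarrow> bool" where
  "has_edge_densities k d V E \<longleftrightarrow>
     (\<forall>i j. 1 \<le> i \<and> i < j \<and> j \<le> k \<longrightarrow>
        \<bar>edge_density E (V i) (V j) - d i j\<bar> < 1 / (real (card (V i)) * real (card (V j))))"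

lemma has_edge_densities_exact:
  assumes pos: "\<And>i. i \<in> {1..k} \<Longrightarrow> card (V i) > 0"
    and int: "\<And>i j. 1 \<le> i \<Longrightarrow> i < j \<Longrightarrow> j \<le> k \<Longrightarrow>
                d i j * (real (card (V i)) * real (card (V j))) \<in> \<int>"
  shows "has_edge_densities k d V E \<longleftrightarrow>
     (\<forall>i j. 1 \<le> i \<and> i < j \<and> j \<le> k \<longrightarrow> edge_density E (V i) (V j) = d i j)"
proof -
  have "\<bar>edge_density E (V i) (V j) - d i j\<bar> < 1 / (real (card (V i)) * real (card (V j)))
      \<longleftrightarrow> edge_density E (V i) (V j) = d i j" if ij: "1 \<le> i" "i < j" "j \<le> k" for i j
  proof -
    define m where "m = real (card (V i)) * real (card (V j))"
    have m: "m > 0"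
      using pos[of i] pos[of j] ij by (simp add: m_def)
    obtain z :: int where z: "d i j * m = of_int z"
      using int[OF ij] by (auto simp: m_def elim: Ints_cases)
    define c where "c = int (card (edges_between E (V i) (V j)))"
    have dens: "edge_density E (V i) (V j) = of_int c / m"
      by (simp add: edge_density_def m_def c_def)
    have d: "d i j = of_int z / m"
      using z m by (simp add: field_simps)
    have "\<bar>of_int c / m - of_int z / m\<bar> = of_int \<bar>c - z\<bar> / m"
      using m by (simp flip: diff_divide_distrib)
    moreover have "of_int \<bar>c - z\<bar> / m < 1 / m \<longleftrightarrow> c = z"
    proof -
      have "of_int \<bar>c - z\<bar> / m < 1 / m \<longleftrightarrow> (of_int \<bar>c - z\<bar> :: real) < 1"
        using m by (simp add: divide_less_cancel)
      also have "\<dots> \<longleftrightarrow> \<bar>c - z\<bar> < 1"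
        by (metis of_int_1 of_int_less_iff)
      finally show ?thesis by auto
    qed
    ultimately show ?thesis
      using m by (simp add: dens d flip: m_def)
  qed
  then show ?thesis
    unfolding has_edge_densities_def by blast
qed

definition independent_transversals ::
    "nat \<Rightarrow> (nat \<Rightarrow> 'a set) \<Rightarrow> 'a set set \<Rightarrow> 'a set set" where
  "independent_transversals k V E =
     {S. S \<subseteq> (\<Union>i\<in>{1..k}. V i) \<and> (\<forall>i\<in>{1..k}. card (S \<inter> V i) = 1) \<and>
         (\<forall>u\<in>S. \<forall>v\<in>S. {u, v} \<notin> E)}"


subsection \<open>Odd cycle decompositions\<close>

text \<open>A component is a pair of a vertex set and a multiset of edges. An undirected edge of
  \<open>K\<^sub>k\<close> is the ordered pair \<open>(i, j)\<close> of its endpoints with \<open>i < j\<close>.\<close>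

type_synonym component = "nat set \<times> (nat \<times> nat) multiset"

definition edge :: "nat \<Rightarrow> nat \<Rightarrow> nat \<times> nat" where
  "edge i j = (min i j, max i j)"

definition is_odd_cycle :: "component \<Rightarrow> bool" where
  "is_odd_cycle F \<longleftrightarrow>
     (\<exists>vs. distinct vs \<and> odd (length vs) \<and> length vs \<ge> 3 \<and>
           F = (set vs, mset (map2 edge vs (rotate1 vs))))"

definition is_double_edge :: "component \<Rightarrow> bool" where
  "is_double_edge F \<longleftrightarrow> (\<exists>i j. i \<noteq> j \<and> F = ({i, j}, {#edge i j, edge i j#}))"

definition is_isolated_vertex :: "component \<Rightarrow> bool" where
  "is_isolated_vertex F \<longleftrightarrow> (\<exists>i. F = ({i}, {#}))"

definition odd_cycle_decompositions :: "nat \<Rightarrow> component set set" where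
  "odd_cycle_decompositions k =
     {H. (\<forall>F\<in>H. is_odd_cycle F \<or> is_double_edge F \<or> is_isolated_vertex F) \<and>
         disjoint_family_on fst H \<and> (\<Union>F\<in>H. fst F) = {1..k}}"

lemma finite_odd_cycle_decompositions: "finite (odd_cycle_decompositions k)"
proof -
  define L where "L = {vs :: nat list. set vs \<subseteq> {1..k} \<and> distinct vs}"
  define P where "P = (\<lambda>vs. (set vs, mset (map2 edge vs (rotate1 vs)))) ` L
      \<union> (\<lambda>(i, j). ({i, j}, {#edge i j, edge i j#})) ` ({1..k} \<times> {1..k})
      \<union> (\<lambda>i. ({i}, {#})) ` {1..k}"
  have "finite P"
    unfolding P_def L_def by (simp add: finite_subset_distinct)
  moreover have "odd_cycle_decompositions k \<subseteq> Pow P"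
  proof
    fix H assume H: "H \<in> odd_cycle_decompositions k"
    have "F \<in> P" if F: "F \<in> H" for F
    proof -
      have sub: "fst F \<subseteq> {1..k}"
        using H F unfolding odd_cycle_decompositions_def by blast
      have "is_odd_cycle F \<or> is_double_edge F \<or> is_isolated_vertex F"
        using H F unfolding odd_cycle_decompositions_def by blast
      then consider vs where "distinct vs" "F = (set vs, mset (map2 edge vs (rotate1 vs)))"
        | i j where "F = ({i, j}, {#edge i j, edge i j#})"
        | i where "F = ({i}, {#})"
        unfolding is_odd_cycle_def is_double_edge_def is_isolated_vertex_def by blast
      then show ?thesis
      proof cases
        case 1
        then show ?thesis using sub unfolding P_def L_def by auto
      next
        case 2
        then have "F \<in> (\<lambda>(i, j). ({i, j}, {#edge i j, edge i j#})) ` ({1..k} \<times> {1..k})"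
          using sub by (intro image_eqI[of _ _ "(i, j)"]) auto
        then show ?thesis unfolding P_def by blast
      next
        case 3
        then show ?thesis using sub unfolding P_def by auto
      qed
    qed
    then show "H \<in> Pow P" by blast
  qed
  ultimately show ?thesis
    by (meson finite_Pow_iff finite_subset)
qed

lemma odd_cycle_decompositions_nonempty: "odd_cycle_decompositions k \<noteq> {}"
proof -
  have "(\<lambda>i. ({i}, {#})) ` {1..k} \<in> odd_cycle_decompositions k"
    unfolding odd_cycle_decompositions_def is_isolated_vertex_def disjoint_family_on_def by auto
  then show ?thesis by blast
qed


subsection \<open>The bound\<close>

definition decomposition_weight :: "(nat \<Rightarrow> nat \<Rightarrow> real) \<Rightarrow> component set \<Rightarrow> real" where
  "decomposition_weight d H = (\<Prod>F\<in>H. \<Prod>(i, j)\<in>#snd F. sqrt (1 - d i j))"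

definition transversal_bound ::
    "nat \<Rightarrow> (nat \<Rightarrow> nat \<Rightarrow> real) \<Rightarrow> (nat \<Rightarrow> nat) \<Rightarrow> real" where
  "transversal_bound k d n =
     (MIN H\<in>odd_cycle_decompositions k. (\<Prod>i=1..k. real (n i)) * decomposition_weight d H)"

text \<open>The filter on size vectors expressing that \<open>n 1, \<dots>, n k\<close> all tend to infinity
  (independently of each other).\<close>

definition sizes_at_top :: "nat \<Rightarrow> (nat \<Rightarrow> nat) filter" where
  "sizes_at_top k = (INF i\<in>{1..k}. filtercomap (\<lambda>n. n i) at_top)"

end

theory Submission
  imports Defs "HOL-Analysis.Convex" "HOL-Combinatorics.Cycles" "HOL-Library.Nat_Bijection"
begin

text \<open>Let \<open>p i j = 1 - d i j\<close> for \<open>i \<noteq> j\<close> and \<open>p i i = 1\<close>. A double edge, an odd cycle and an isolated vertex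
  are the orbits of a permutation \<open>\<sigma>\<close>, and then the weight of the decomposition is
  \<open>\<Prod>i. sqrt (p i (\<sigma> i))\<close>. For the upper bound, the indicators of the non-edges at the pairs
  \<open>(i, \<sigma> i)\<close> depend on each coordinate at most twice, so that repeated use of the Cauchy-Schwarz
  inequality bounds the average of their product by the product of their \<open>L\<^sup>2\<close> norms. For the lower
  bound, linear programming duality for the assignment problem with the costs \<open>- ln (p i j)\<close> yields
  a permutation \<open>\<sigma>\<close> and numbers \<open>a i \<in> [0, 1]\<close> with \<open>a i * a j \<le> p i j\<close> and
  \<open>\<Prod>i. a i = \<Prod>i. sqrt (p i (\<sigma> i))\<close>. An even orbit of \<open>\<sigma>\<close> splits into two perfect
  matchings, one of which weighs at most as much as the orbit, so some decomposition weighs at most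
  \<open>\<Prod>i. a i\<close>. A graph without edges between sets of \<open>a i * n i\<close> vertices of each part attains
  this bound.\<close>

subsection \<open>Averages over a product\<close>

definition avg :: "'i set \<Rightarrow> ('i \<Rightarrow> 'a set) \<Rightarrow> (('i \<Rightarrow> 'a) \<Rightarrow> real) \<Rightarrow> real" where
  "avg S V f = (\<Sum>x\<in>Pi\<^sub>E S V. f x) / (\<Prod>i\<in>S. real (card (V i)))"

lemma sum_PiE_insert:
  assumes "v \<notin> S"
  shows "(\<Sum>x\<in>Pi\<^sub>E (insert v S) V. f x) = (\<Sum>y\<in>Pi\<^sub>E S V. \<Sum>t\<in>V v. f (y(v := t)))"
proof -
  have "(\<Sum>x\<in>Pi\<^sub>E (insert v S) V. f x) = (\<Sum>(t, y)\<in>V v \<times> Pi\<^sub>E S V. f (y(v := t)))"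
    unfolding PiE_insert_eq
    by (subst sum.reindex[OF inj_combinator[OF assms]]) (simp add: case_prod_unfold)
  also have "\<dots> = (\<Sum>t\<in>V v. \<Sum>y\<in>Pi\<^sub>E S V. f (y(v := t)))"
    by (simp add: sum.cartesian_product)
  also have "\<dots> = (\<Sum>y\<in>Pi\<^sub>E S V. \<Sum>t\<in>V v. f (y(v := t)))"
    by (rule sum.swap)
  finally show ?thesis .
qed

lemma avg_insert:
  assumes "finite S" "v \<notin> S"
  shows "avg (insert v S) V f = avg S V (\<lambda>y. (\<Sum>t\<in>V v. f (y(v := t))) / real (card (V v)))"
  using assms unfolding avg_def
  by (simp add: sum_PiE_insert sum_divide_distrib[symmetric] mult.commute)

lemma avg_mono:
  assumes "\<And>x. x \<in> Pi\<^sub>E S V \<Longrightarrow> f x \<le> g x"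
  shows "avg S V f \<le> avg S V g"
  unfolding avg_def by (intro divide_right_mono sum_mono assms prod_nonneg) auto

text \<open>Cauchy-Schwarz for the uniform probability measure on \<open>A\<close>. As the total
  mass is 1, the constant 1 has norm 1 and a single factor can be paired with it; without factors
  both sides are 1.\<close>

lemma sum_prod_le_of_two:
  fixes f :: "'e \<Rightarrow> 'a \<Rightarrow> real"
  assumes "finite D" "card D \<le> 2" "finite A" "A \<noteq> {}"
    and nonneg: "\<And>e t. f e t \<ge> 0"
  shows "(\<Sum>t\<in>A. \<Prod>e\<in>D. f e t) / card A \<le> (\<Prod>e\<in>D. sqrt ((\<Sum>t\<in>A. (f e t)\<^sup>2) / card A))"
proof -
  have A: "card A > 0" using assms by (simp add: card_gt_0_iff)
  have CS: "(\<Sum>t\<in>A. a t * b t) / card A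
      \<le> sqrt ((\<Sum>t\<in>A. (a t)\<^sup>2) / card A) * sqrt ((\<Sum>t\<in>A. (b t)\<^sup>2) / card A)"
    for a b :: "'a \<Rightarrow> real"
  proof -
    have "(\<Sum>t\<in>A. a t * b t) \<le> sqrt ((\<Sum>t\<in>A. (a t)\<^sup>2) * (\<Sum>t\<in>A. (b t)\<^sup>2))"
      by (intro real_le_rsqrt Cauchy_Schwarz_ineq_sum)
    then show ?thesis
      using A by (simp add: real_sqrt_mult real_sqrt_divide divide_right_mono)
  qed
  consider "card D = 0" | "card D = 1" | "card D = 2" using assms(2) by linarith
  then show ?thesis
  proof cases
    case 1
    then show ?thesis using assms by simp
  next
    case 2
    then obtain e where "D = {e}" by (auto simp: card_1_singleton_iff)
    then show ?thesis using CS[of "f e" "\<lambda>_. 1"] A by simp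
  next
    case 3
    then obtain e e' where "D = {e, e'}" "e \<noteq> e'" by (auto simp: card_2_iff)
    then show ?thesis using CS[of "f e" "f e'"] by simp
  qed
qed

text \<open>The degree-two case of Finner's inequality, by integrating out one coordinate at a time.\<close>

lemma avg_prod_le:
  fixes f :: "'e \<Rightarrow> ('i \<Rightarrow> 'a) \<Rightarrow> real"
  assumes "finite S" "finite L"
    and "\<And>v. v \<in> S \<Longrightarrow> finite (V v) \<and> V v \<noteq> {}"
    and "\<And>v. v \<in> S \<Longrightarrow> card {e \<in> L. v \<in> T e} \<le> 2"
    and "\<And>e x. f e x \<ge> 0"
    and "\<And>e v x t. v \<notin> T e \<Longrightarrow> f e (x(v := t)) = f e x"
  shows "avg S V (\<lambda>x. \<Prod>e\<in>L. f e x) \<le> (\<Prod>e\<in>L. sqrt (avg S V (\<lambda>x. (f e x)\<^sup>2)))"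
  using assms(1,3-)
proof (induction S arbitrary: f rule: finite_induct)
  case empty
  then show ?case by (simp add: avg_def)
next
  case (insert v S)
  define n where "n = real (card (V v))"
  have n: "n > 0" using insert.prems(1)[of v] by (simp add: n_def card_gt_0_iff)
  \<comment> \<open>The quadratic mean of \<open>f e\<close> over the coordinate \<open>v\<close>;
    for a factor that ignores \<open>v\<close> it is \<open>f e\<close> itself.\<close>
  define g where "g e y = sqrt ((\<Sum>t\<in>V v. (f e (y(v := t)))\<^sup>2) / n)" for e y
  have g0: "g e y \<ge> 0" for e y
    using n by (auto simp: g_def intro!: divide_nonneg_nonneg sum_nonneg)
  have g2: "(g e y)\<^sup>2 = (\<Sum>t\<in>V v. (f e (y(v := t)))\<^sup>2) / n" for e y
    using n by (auto simp: g_def intro!: divide_nonneg_nonneg sum_nonneg)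
  \<comment> \<open>Factors outside \<open>D\<close> are constant in \<open>t\<close> and leave the
    sum; at most two remain, and Cauchy-Schwarz applies to them.\<close>
  have step: "(\<Sum>t\<in>V v. \<Prod>e\<in>L. f e (y(v := t))) / n \<le> (\<Prod>e\<in>L. g e y)" for y
  proof -
    define D where "D = {e \<in> L. v \<in> T e}"
    have D: "finite D" "D \<subseteq> L" using assms(2) by (auto simp: D_def)
    have split: "prod h L = prod h (L - D) * prod h D" for h :: "'e \<Rightarrow> real"
      using prod.subset_diff[OF D(2) assms(2)] by simp
    have const: "(\<Prod>e\<in>L - D. f e (y(v := t))) = (\<Prod>e\<in>L - D. f e y)" for t
      by (intro prod.cong refl insert.prems(4)) (auto simp: D_def)
    have gconst: "(\<Prod>e\<in>L - D. g e y) = (\<Prod>e\<in>L - D. f e y)"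
    proof (intro prod.cong refl)
      fix e assume e: "e \<in> L - D"
      have "f e (y(v := t)) = f e y" for t
        using e by (intro insert.prems(4)) (auto simp: D_def)
      then show "g e y = f e y"
        using n insert.prems(3) by (simp add: g_def n_def)
    qed
    have "(\<Sum>t\<in>V v. \<Prod>e\<in>L. f e (y(v := t))) / n
        = (\<Prod>e\<in>L - D. f e y) * ((\<Sum>t\<in>V v. \<Prod>e\<in>D. f e (y(v := t))) / n)"
      by (simp add: split const sum_distrib_left)
    also have "\<dots> \<le> (\<Prod>e\<in>L - D. f e y) * (\<Prod>e\<in>D. g e y)"
      unfolding n_def g_def
      using insert.prems(1)[of v] insert.prems(2)[of v] D(1)
      by (intro mult_left_mono sum_prod_le_of_two prod_nonneg insert.prems(3) ballI)
        (auto simp: D_def)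
    also have "\<dots> = (\<Prod>e\<in>L. g e y)" by (simp add: split gconst)
    finally show ?thesis .
  qed
  have "avg (insert v S) V (\<lambda>x. \<Prod>e\<in>L. f e x)
      = avg S V (\<lambda>y. (\<Sum>t\<in>V v. \<Prod>e\<in>L. f e (y(v := t))) / n)"
    using insert.hyps by (simp add: avg_insert n_def)
  also have "\<dots> \<le> avg S V (\<lambda>y. \<Prod>e\<in>L. g e y)"
    by (intro avg_mono step)
  also have "\<dots> \<le> (\<Prod>e\<in>L. sqrt (avg S V (\<lambda>y. (g e y)\<^sup>2)))"
  proof (rule insert.IH)
    \<comment> \<open>The means inherit the independence of coordinates outside \<open>T e\<close>:
      updates at distinct coordinates commute, and an update at \<open>v\<close> is overwritten
      inside \<open>g\<close>.\<close>
    show "g e (x(v' := t)) = g e x" if "v' \<notin> T e" for e v' x t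
    proof (cases "v' = v")
      case False
      then have "x(v' := t, v := s) = x(v := s, v' := t)" for s
        by (simp add: fun_upd_twist)
      then show ?thesis unfolding g_def by (simp only: insert.prems(4)[OF that])
    qed (simp add: g_def)
  qed (use insert.prems g0 in auto)
  also have "\<dots> = (\<Prod>e\<in>L. sqrt (avg (insert v S) V (\<lambda>x. (f e x)\<^sup>2)))"
    using insert.hyps by (simp add: avg_insert g2 n_def)
  finally show ?case .
qed

subsection \<open>Duality for the assignment problem\<close>

text \<open>Rotation by one sends each entry to its image under \<open>cycle_of_list xs\<close>.
  This links the lists in the definition of an odd cycle to products over an orbit of a
  permutation.\<close>

lemma map2_rotate1:
  assumes "distinct xs"
  shows "map2 g xs (rotate1 xs) = map (\<lambda>x. g x (cycle_of_list xs x)) xs"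
proof -
  have "rotate1 xs = map (cycle_of_list xs) xs"
    using cyclic_rotation[OF assms, of 1] by simp
  then show ?thesis
    by (simp add: zip_map2 zip_same_conv_map)
qed

lemma prod_cycle_of_list:
  assumes "distinct xs"
  shows "(\<Prod>x\<in>set xs. g x (cycle_of_list xs x)) = prod_list (map2 g xs (rotate1 xs))"
  unfolding map2_rotate1[OF assms] using assms by (simp add: prod.distinct_set_conv_list)

lemma sum_cycle_of_list:
  assumes "distinct xs"
  shows "(\<Sum>x\<in>set xs. g x (cycle_of_list xs x)) = sum_list (map2 g xs (rotate1 xs))"
  unfolding map2_rotate1[OF assms] using assms by (simp add: sum.distinct_set_conv_list)

fun path_weight :: "('a \<Rightarrow> 'a \<Rightarrow> real) \<Rightarrow> 'a list \<Rightarrow> real" where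
  "path_weight w (x # y # xs) = w x y + path_weight w (y # xs)"
| "path_weight w xs = 0"

lemma path_weight_append:
  "path_weight w (xs @ y # ys) = path_weight w (xs @ [y]) + path_weight w (y # ys)"
  by (induction w xs rule: path_weight.induct) (auto simp: neq_Nil_conv)

text \<open>For \<open>z = x\<close> the right-hand side is the cyclic sum over
  \<open>x # ys\<close>, since \<open>rotate1 (x # ys) = ys @ [x]\<close>; thus a bound on cycles
  applies to closed paths.\<close>

lemma path_weight_eq_sum_list:
  "path_weight w (x # ys @ [z]) = sum_list (map2 w (x # ys) (ys @ [z]))"
  by (induction ys arbitrary: x) auto

text \<open>The potential of a vertex is the largest weight of a simple path starting there.\<close>

lemma exists_potential:
  fixes w :: "'a \<Rightarrow> 'a \<Rightarrow> real"
  assumes "finite S"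
    and cyc: "\<And>xs. distinct xs \<Longrightarrow> set xs \<subseteq> S \<Longrightarrow> xs \<noteq> [] \<Longrightarrow> sum_list (map2 w xs (rotate1 xs)) \<le> 0"
  shows "\<exists>u. \<forall>i\<in>S. \<forall>j\<in>S. w i j + u j \<le> u i"
proof -
  define P where "P i = {xs. set xs \<subseteq> S \<and> distinct xs \<and> xs \<noteq> [] \<and> hd xs = i}" for i
  define u where "u i = Max (path_weight w ` P i)" for i
  have fin: "finite (P i)" for i
    by (rule finite_subset[OF _ finite_subset_distinct[OF assms(1)]]) (auto simp: P_def)
  have ne: "P i \<noteq> {}" if "i \<in> S" for i
  proof -
    have "[i] \<in> P i" using that by (auto simp: P_def)
    then show ?thesis by blast
  qed
  have le: "path_weight w xs \<le> u i" if "xs \<in> P i" for xs i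
    unfolding u_def using fin that by (intro Max_ge) auto
  have "w i j + u j \<le> u i" if ij: "i \<in> S" "j \<in> S" for i j
  proof -
    have "u j \<in> path_weight w ` P j"
      unfolding u_def using fin ne[OF ij(2)] by (intro Max_in) auto
    then obtain xs where xs: "xs \<in> P j" "u j = path_weight w xs" by blast
    have eq: "path_weight w (i # xs) = w i j + u j"
      using xs by (cases xs) (auto simp: P_def)
    \<comment> \<open>If the best path from \<open>j\<close> avoids \<open>i\<close>, prepending
      \<open>i\<close> keeps it simple. Otherwise the first visit to \<open>i\<close> closes a cycle
      of weight at most 0; cutting it off leaves a simple path that starts at
      \<open>i\<close>.\<close>
    show ?thesis
    proof (cases "i \<in> set xs")
      case False
      then have "i # xs \<in> P i" using xs ij by (auto simp: P_def)
      then show ?thesis using le eq by fastforce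
    next
      case True
      then obtain ys zs where split: "xs = ys @ i # zs" "i \<notin> set ys"
        by (meson split_list_first)
      have "path_weight w (i # xs) = path_weight w (i # ys @ [i]) + path_weight w (i # zs)"
        using path_weight_append[of w "i # ys" i zs] by (simp add: split)
      moreover have "path_weight w (i # ys @ [i]) \<le> 0"
        using cyc[of "i # ys"] xs ij split
        unfolding path_weight_eq_sum_list by (auto simp: P_def)
      moreover have "path_weight w (i # zs) \<le> u i"
        using xs split by (intro le) (auto simp: P_def)
      ultimately show ?thesis using eq by linarith
    qed
  qed
  then show ?thesis by blast
qed

text \<open>An optimal permutation \<sigma> cannot be improved by composing it with a cycle, so the
  exchange gains have no positive cycle and admit a potential. This potential is \<open>u\<close>;
  complementary slackness along \<sigma> then dictates \<open>v\<close>.\<close>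

lemma assignment_duality:
  fixes M :: "'a \<Rightarrow> 'a \<Rightarrow> real"
  assumes "finite S"
  obtains \<sigma> u v where "\<sigma> permutes S"
    and "\<And>i j. i \<in> S \<Longrightarrow> j \<in> S \<Longrightarrow> M i j \<le> u i + v j"
    and "(\<Sum>i\<in>S. u i + v i) = (\<Sum>i\<in>S. M i (\<sigma> i))"
proof -
  define val where "val \<sigma> = (\<Sum>i\<in>S. M i (\<sigma> i))" for \<sigma>
  have fin: "finite {\<sigma>. \<sigma> permutes S}" by (rule finite_permutations[OF assms])
  have "Max (val ` {\<sigma>. \<sigma> permutes S}) \<in> val ` {\<sigma>. \<sigma> permutes S}"
    using fin by (intro Max_in) (auto intro: permutes_id)
  then obtain \<sigma> where \<sigma>: "\<sigma> permutes S" "val \<sigma> = Max (val ` {\<sigma>. \<sigma> permutes S})" by auto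
  have opt: "val \<tau> \<le> val \<sigma>" if "\<tau> permutes S" for \<tau>
    unfolding \<sigma>(2) using fin that by (intro Max_ge) auto
  \<comment> \<open>The gain when row \<open>i\<close> takes over the column
    \<open>\<sigma> j\<close> from row \<open>j\<close>. Summed around a cycle \<tau>, the gains
    give \<open>val (\<sigma> \<circ> \<tau>) - val \<sigma>\<close>.\<close>
  define w where "w i j = M i (\<sigma> j) - M j (\<sigma> j)" for i j
  have "sum_list (map2 w xs (rotate1 xs)) \<le> 0" if xs: "distinct xs" "set xs \<subseteq> S" for xs
  proof -
    define \<tau> where "\<tau> = cycle_of_list xs"
    have \<tau>: "\<tau> permutes set xs" unfolding \<tau>_def by (rule cycle_permutes)
    have split: "sum h S = sum h (S - set xs) + sum h (set xs)" for h :: "'a \<Rightarrow> real"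
      using sum.subset_diff[OF xs(2) assms] by simp
    have "val (\<sigma> \<circ> \<tau>) \<le> val \<sigma>"
      by (intro opt permutes_compose permutes_subset[OF \<tau> xs(2)] \<sigma>(1))
    moreover have "(\<Sum>i\<in>S - set xs. M i (\<sigma> (\<tau> i))) = (\<Sum>i\<in>S - set xs. M i (\<sigma> i))"
      using \<tau> by (intro sum.cong refl) (auto simp: permutes_not_in)
    ultimately have "(\<Sum>i\<in>set xs. M i (\<sigma> (\<tau> i))) \<le> (\<Sum>i\<in>set xs. M i (\<sigma> i))"
      by (simp add: val_def split)
    also have "(\<Sum>i\<in>set xs. M i (\<sigma> i)) = (\<Sum>i\<in>set xs. M (\<tau> i) (\<sigma> (\<tau> i)))"
      by (rule sum.permute[OF \<tau>, unfolded o_def])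
    finally have "(\<Sum>i\<in>set xs. w i (\<tau> i)) \<le> 0"
      by (simp add: w_def sum_subtractf)
    then show ?thesis using sum_cycle_of_list[OF xs(1), of w] by (simp add: \<tau>_def)
  qed
  then obtain u where u: "\<And>i j. i \<in> S \<Longrightarrow> j \<in> S \<Longrightarrow> w i j + u j \<le> u i"
    using exists_potential[OF assms, of w] by blast
  \<comment> \<open>The choice that makes the dual constraint tight at every pair
    \<open>(i, \<sigma> i)\<close>.\<close>
  define v where "v j = M (inv \<sigma> j) j - u (inv \<sigma> j)" for j
  have v: "v (\<sigma> j) = M j (\<sigma> j) - u j" for j
    using permutes_inverses(2)[OF \<sigma>(1)] by (simp add: v_def)
  show ?thesis
  proof
    show "\<sigma> permutes S" by fact
    fix i j assume ij: "i \<in> S" "j \<in> S"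
    define j' where "j' = inv \<sigma> j"
    have j': "j' \<in> S" "j = \<sigma> j'"
      using ij permutes_in_image[OF permutes_inv[OF \<sigma>(1)]] permutes_inverses(1)[OF \<sigma>(1)]
      by (auto simp: j'_def)
    show "M i j \<le> u i + v j"
      using u[OF ij(1) j'(1)] unfolding j'(2) v by (simp add: w_def)
  next
    have "(\<Sum>i\<in>S. v i) = (\<Sum>i\<in>S. v (\<sigma> i))"
      by (rule sum.permute[OF \<sigma>(1), unfolded o_def])
    then show "(\<Sum>i\<in>S. u i + v i) = (\<Sum>i\<in>S. M i (\<sigma> i))"
      by (simp add: v sum.distrib sum_subtractf)
  qed
qed

subsection \<open>Decompositions and permutations\<close>

text \<open>The vertex set is arbitrary so that decompositions can be built and taken apart one
  component or orbit at a time; \<open>A = {1..k}\<close> gives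
  \<open>odd_cycle_decompositions k\<close>.\<close>

definition decomposes :: "component set \<Rightarrow> nat set \<Rightarrow> bool" where
  "decomposes H A \<longleftrightarrow>
     (\<forall>F\<in>H. is_odd_cycle F \<or> is_double_edge F \<or> is_isolated_vertex F) \<and>
     disjoint_family_on fst H \<and> (\<Union>F\<in>H. fst F) = A"

definition component_weight :: "(nat \<Rightarrow> nat \<Rightarrow> real) \<Rightarrow> component \<Rightarrow> real" where
  "component_weight w F = (\<Prod>(i, j)\<in>#snd F. w i j)"

lemma component_nonempty:
  "is_odd_cycle F \<or> is_double_edge F \<or> is_isolated_vertex F \<Longrightarrow> fst F \<noteq> {}"
  unfolding is_odd_cycle_def is_double_edge_def is_isolated_vertex_def by auto

text \<open>Disjoint nonempty vertex sets are distinct, so \<open>fst\<close> embeds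
  \<open>H\<close> into the power set of \<open>A\<close>.\<close>

lemma decomposes_finite:
  assumes "decomposes H A" "finite A"
  shows "finite H"
proof (rule finite_imageD)
  have "fst ` H \<subseteq> Pow A" using assms(1) by (auto simp: decomposes_def)
  then show "finite (fst ` H)" using assms(2) by (meson finite_Pow_iff finite_subset)
  show "inj_on fst H"
    using assms(1) component_nonempty unfolding decomposes_def disjoint_family_on_def inj_on_def
    by (metis Int_absorb)
qed

lemma decomposes_empty: "decomposes {} {}"
  by (simp add: decomposes_def disjoint_family_on_def)

lemma decomposes_insert:
  assumes "is_odd_cycle F \<or> is_double_edge F \<or> is_isolated_vertex F"
    and "decomposes H A" "fst F \<inter> A = {}"
  shows "decomposes (insert F H) (fst F \<union> A)" "F \<notin> H"
proof -
  show "F \<notin> H"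
    using assms component_nonempty[OF assms(1)] unfolding decomposes_def by blast
  show "decomposes (insert F H) (fst F \<union> A)"
    using assms unfolding decomposes_def disjoint_family_on_def by auto
qed

lemma decomposes_Un:
  assumes "decomposes H A" "decomposes H' B" "A \<inter> B = {}"
  shows "decomposes (H \<union> H') (A \<union> B)" "H \<inter> H' = {}"
proof -
  show "H \<inter> H' = {}"
    using assms component_nonempty unfolding decomposes_def by blast
  have "fst F \<inter> fst G = {}" if "F \<in> H" "G \<in> H'" for F G
    using assms that unfolding decomposes_def by blast
  then have "fst F \<inter> fst G = {}" "fst G \<inter> fst F = {}" if "F \<in> H" "G \<in> H'" for F G
    using that by blast+
  moreover have "disjoint_family_on fst H" "disjoint_family_on fst H'"
    using assms by (simp_all add: decomposes_def)
  ultimately have "disjoint_family_on fst (H \<union> H')"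
    by (simp add: disjoint_family_on_def ball_Un)
  then show "decomposes (H \<union> H') (A \<union> B)"
    using assms unfolding decomposes_def by (simp add: ball_Un)
qed

text \<open>On a list of even length and on its rotation this yields the two perfect matchings of an
  even cycle, each edge doubled.\<close>

fun pairs :: "nat list \<Rightarrow> component set" where
  "pairs (a # b # xs) = insert ({a, b}, {#edge a b, edge a b#}) (pairs xs)"
| "pairs xs = {}"

fun pairs_weight :: "(nat \<Rightarrow> nat \<Rightarrow> real) \<Rightarrow> nat list \<Rightarrow> real" where
  "pairs_weight w (a # b # xs) = (w a b)\<^sup>2 * pairs_weight w xs"
| "pairs_weight w xs = 1"

text \<open>Consecutive edges of a cycle alternate between two matchings, and a doubled edge
  contributes the square of its weight. A free last vertex \<open>z\<close> in place of the head of
  \<open>xs\<close> lets the induction drop two entries at a time; for \<open>z = hd xs\<close> the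
  shifted list is \<open>rotate1 xs\<close>.\<close>

lemma prod_list_cyclic_squared:
  assumes "even (length xs)"
  shows "(prod_list (map2 w xs (tl xs @ [z])))\<^sup>2 = pairs_weight w xs * pairs_weight w (tl xs @ [z])"
  using assms
proof (induction w xs rule: pairs_weight.induct)
  case (1 w a b xs)
  then show ?case by (cases xs) (auto simp: power_mult_distrib)
qed auto

lemma prod_permutes_disjoint:
  assumes "p permutes A" "q permutes B" "A \<inter> B = {}" "finite A" "finite B"
  shows "q \<circ> p permutes (B \<union> A)"
    and "(\<Prod>i\<in>B \<union> A. g i ((q \<circ> p) i)) = (\<Prod>i\<in>B. g i (q i)) * (\<Prod>i\<in>A. g i (p i))"
proof -
  show "q \<circ> p permutes (B \<union> A)"
    by (intro permutes_compose permutes_subset[OF assms(1)] permutes_subset[OF assms(2)]) auto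
  have "(\<Prod>i\<in>B \<union> A. g i ((q \<circ> p) i))
      = (\<Prod>i\<in>B. g i ((q \<circ> p) i)) * (\<Prod>i\<in>A. g i ((q \<circ> p) i))"
    using assms by (intro prod.union_disjoint) auto
  also have "(\<Prod>i\<in>B. g i ((q \<circ> p) i)) = (\<Prod>i\<in>B. g i (q i))"
  proof (intro prod.cong refl)
    fix i assume "i \<in> B"
    then have "p i = i" using assms(3) by (intro permutes_not_in[OF assms(1)]) auto
    then show "g i ((q \<circ> p) i) = g i (q i)" by simp
  qed
  also have "(\<Prod>i\<in>A. g i ((q \<circ> p) i)) = (\<Prod>i\<in>A. g i (p i))"
  proof (intro prod.cong refl)
    fix i assume "i \<in> A"
    then have "p i \<notin> B" using assms permutes_in_image[OF assms(1)] by auto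
    then show "g i ((q \<circ> p) i) = g i (p i)" using permutes_not_in[OF assms(2)] by simp
  qed
  finally show "(\<Prod>i\<in>B \<union> A. g i ((q \<circ> p) i)) = (\<Prod>i\<in>B. g i (q i)) * (\<Prod>i\<in>A. g i (p i))" .
qed

lemma cycle_decomp_permutes:
  "cycle_decomp I p \<Longrightarrow> p permutes I \<and> finite I"
proof (induction rule: cycle_decomp.induct)
  case (comp I p cs)
  then have "I \<inter> set cs = {}" by blast
  then show ?case
    using prod_permutes_disjoint(1)[OF _ cycle_permutes[of cs]] comp.IH by blast
qed (auto simp: permutes_id)

section \<open>Weights of decompositions and of permutations\<close>

context
  fixes w :: "nat \<Rightarrow> nat \<Rightarrow> real"
  assumes sym: "\<And>i j. w i j = w j i"
    and diag: "\<And>i. w i i = 1"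
    and nonneg: "\<And>i j. w i j \<ge> 0"
begin

lemma weight_edge: "(case edge a b of (i, j) \<Rightarrow> w i j) = w a b"
  using sym by (auto simp: edge_def min_def max_def)

lemma component_weight_nonneg: "component_weight w F \<ge> 0"
proof -
  have "(\<Prod>(i, j)\<in>#M. w i j) \<ge> 0" for M
    using nonneg by (induction M) auto
  then show ?thesis by (simp add: component_weight_def)
qed

lemma component_weight_cycle:
  "component_weight w (set cs, mset (map2 edge cs (rotate1 cs))) = prod_list (map2 w cs (rotate1 cs))"
proof -
  have "component_weight w (set cs, mset (map2 edge cs (rotate1 cs)))
      = prod_list (map (\<lambda>e. case e of (i, j) \<Rightarrow> w i j) (map2 edge cs (rotate1 cs)))"
    unfolding component_weight_def by (simp only: snd_conv mset_map[symmetric] prod_mset_prod_list)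
  also have "\<dots> = prod_list (map2 w cs (rotate1 cs))"
    by (simp add: o_def case_prod_unfold weight_edge[unfolded case_prod_unfold])
  finally show ?thesis .
qed

lemma component_weight_double: "component_weight w ({a, b}, {#edge a b, edge a b#}) = (w a b)\<^sup>2"
  by (simp add: component_weight_def weight_edge power2_eq_square)

lemma pairs_decomposes:
  assumes "distinct xs" "even (length xs)"
  shows "decomposes (pairs xs) (set xs) \<and> prod (component_weight w) (pairs xs) = pairs_weight w xs"
  using assms
proof (induction xs rule: pairs.induct)
  case (1 a b xs)
  then have IH: "decomposes (pairs xs) (set xs)"
      "prod (component_weight w) (pairs xs) = pairs_weight w xs" by auto
  define F where "F = ({a, b}, {#edge a b, edge a b#})"
  have F: "is_odd_cycle F \<or> is_double_edge F \<or> is_isolated_vertex F" "fst F \<inter> set xs = {}"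
    using 1(2) by (auto simp: F_def is_double_edge_def)
  have "finite (pairs xs)" using decomposes_finite[OF IH(1)] by simp
  then have "prod (component_weight w) (insert F (pairs xs)) = pairs_weight w (a # b # xs)"
    using decomposes_insert(2)[OF F(1) IH(1) F(2)] IH(2)
    by (simp add: F_def component_weight_double)
  then show ?case
    using decomposes_insert(1)[OF F(1) IH(1) F(2)] by (simp add: F_def insert_commute)
qed (auto simp: decomposes_empty)

text \<open>An even cycle is the union of two perfect matchings, and the lighter one is at most
  the geometric mean of the two.\<close>

lemma cycle_to_decomposition:
  assumes "distinct cs"
  shows "\<exists>H. decomposes H (set cs) \<and>
    prod (component_weight w) H \<le> prod_list (map2 w cs (rotate1 cs))"
proof (cases "even (length cs)")
  case True
  show ?thesis
  proof (cases cs)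
    case Nil
    then show ?thesis using decomposes_empty by force
  next
    case (Cons a as)
    then have rot: "rotate1 cs = tl cs @ [a]" by simp
    define P where "P = prod_list (map2 w cs (rotate1 cs))"
    have sq: "P\<^sup>2 = pairs_weight w cs * pairs_weight w (rotate1 cs)"
      unfolding P_def rot by (rule prod_list_cyclic_squared[OF True])
    have P: "P \<ge> 0"
      using nonneg by (auto simp: P_def intro!: prod_list_nonneg)
    have "pairs_weight w cs \<le> P \<or> pairs_weight w (rotate1 cs) \<le> P"
    proof (rule ccontr)
      assume "\<not> ?thesis"
      then have "P * P < pairs_weight w cs * pairs_weight w (rotate1 cs)"
        using P by (intro mult_strict_mono') auto
      then show False using sq by (simp add: power2_eq_square)
    qed
    then show ?thesis
      using pairs_decomposes[of cs] pairs_decomposes[of "rotate1 cs"] assms True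
      unfolding P_def by fastforce
  qed
next
  case False
  \<comment> \<open>A list with one entry stands for a fixed point, whose factor
    \<open>w a a = 1\<close> agrees with the empty product of the isolated vertex. Any other odd
    length is at least 3.\<close>
  show ?thesis
  proof (cases "length cs = 1")
    case True
    then obtain a where a: "cs = [a]" by (auto simp: length_Suc_conv)
    have "is_isolated_vertex ({a}, {#})" by (auto simp: is_isolated_vertex_def)
    then have "decomposes {({a}, {#})} (set cs)"
      using decomposes_insert(1)[OF _ decomposes_empty, of "({a}, {#})"] a by auto
    moreover have "prod (component_weight w) {({a}, {#})} \<le> prod_list (map2 w cs (rotate1 cs))"
      by (simp add: a component_weight_def diag)
    ultimately show ?thesis by blast
  next
    case len: False
    define F where "F = (set cs, mset (map2 edge cs (rotate1 cs)))"
    have "length cs \<ge> 3" using False len by presburger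
    then have "is_odd_cycle F" unfolding is_odd_cycle_def F_def using False assms by blast
    then have "decomposes {F} (set cs)"
      using decomposes_insert(1)[OF _ decomposes_empty, of F] by (auto simp: F_def)
    moreover have "prod (component_weight w) {F} = prod_list (map2 w cs (rotate1 cs))"
      unfolding F_def using component_weight_cycle[of cs] by (simp del: mset_map)
    ultimately show ?thesis by fastforce
  qed
qed

text \<open>The orbits are treated separately and the resulting decompositions united. The weight
  may drop, since an even orbit is replaced by one of its matchings.\<close>

lemma permutation_to_decomposition:
  assumes "\<sigma> permutes A" "finite A"
  shows "\<exists>H. decomposes H A \<and> prod (component_weight w) H \<le> (\<Prod>i\<in>A. w i (\<sigma> i))"
  using cycle_decomposition[OF assms]
proof (induction rule: cycle_decomp.induct)
  case empty
  then show ?case using decomposes_empty by force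
next
  case (comp I p cs)
  have I: "p permutes I" "finite I" using cycle_decomp_permutes[OF comp.hyps(1)] by auto
  obtain H where H: "decomposes H I" "prod (component_weight w) H \<le> (\<Prod>i\<in>I. w i (p i))"
    using comp.IH by blast
  obtain H' where H': "decomposes H' (set cs)"
      "prod (component_weight w) H' \<le> prod_list (map2 w cs (rotate1 cs))"
    using cycle_to_decomposition[OF comp.hyps(2)] by blast
  have fin: "finite H" "finite H'" using decomposes_finite H(1) H'(1) I by auto
  have "prod (component_weight w) (H' \<union> H) = prod (component_weight w) H' * prod (component_weight w) H"
    using fin decomposes_Un(2)[OF H'(1) H(1) comp.hyps(3)] by (intro prod.union_disjoint)
  also have "\<dots> \<le> prod_list (map2 w cs (rotate1 cs)) * (\<Prod>i\<in>I. w i (p i))"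
    using nonneg component_weight_nonneg by (intro mult_mono H H' prod_nonneg prod_list_nonneg) auto
  also have "\<dots> = (\<Prod>i\<in>set cs \<union> I. w i ((cycle_of_list cs \<circ> p) i))"
    using prod_permutes_disjoint(2)[OF I(1) cycle_permutes, of cs w] comp.hyps I(2)
    by (simp add: prod_cycle_of_list Int_commute)
  finally show ?case using decomposes_Un(1)[OF H'(1) H(1) comp.hyps(3)] by blast
qed

text \<open>A double edge is a 2-cycle, which runs along its edge in both directions and by symmetry
  weighs \<open>(w i j)\<^sup>2\<close>; an isolated vertex is a 1-cycle of weight
  \<open>w i i = 1\<close>.\<close>

lemma component_to_cycle:
  assumes "is_odd_cycle F \<or> is_double_edge F \<or> is_isolated_vertex F"
  obtains cs where "distinct cs" "set cs = fst F"
    "prod_list (map2 w cs (rotate1 cs)) = component_weight w F"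
proof -
  consider "is_odd_cycle F" | "is_double_edge F" | "is_isolated_vertex F" using assms by blast
  then show ?thesis
  proof cases
    case 1
    then show ?thesis
      unfolding is_odd_cycle_def using that component_weight_cycle by fastforce
  next
    case 2
    then obtain i j where "i \<noteq> j" "F = ({i, j}, {#edge i j, edge i j#})"
      unfolding is_double_edge_def by blast
    then show ?thesis
      using that[of "[i, j]"] sym[of j i] component_weight_double[of i j]
      by (simp add: power2_eq_square)
  next
    case 3
    then obtain i where "F = ({i}, {#})" unfolding is_isolated_vertex_def by blast
    then show ?thesis using that[of "[i]"] by (simp add: component_weight_def diag)
  qed
qed

text \<open>Composing the cycles of the components gives a permutation whose orbits are their vertex
  sets. Here the weights agree exactly, so an upper bound for permutations covers every
  decomposition.\<close>

lemma decomposition_to_permutation: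
  assumes "decomposes H A" "finite A"
  shows "\<exists>\<sigma>. \<sigma> permutes A \<and> (\<Prod>i\<in>A. w i (\<sigma> i)) = prod (component_weight w) H"
  using decomposes_finite[OF assms] assms
proof (induction H arbitrary: A rule: finite_induct)
  case empty
  then have "A = {}" by (simp add: decomposes_def)
  then show ?case using permutes_id by fastforce
next
  case (insert F H)
  define B where "B = (\<Union>F\<in>H. fst F)"
  have F: "is_odd_cycle F \<or> is_double_edge F \<or> is_isolated_vertex F"
    using insert.prems by (simp add: decomposes_def)
  have "fst G \<inter> fst F = {}" if "G \<in> H" for G
    using insert.prems insert.hyps that by (auto simp: decomposes_def disjoint_family_on_def)
  then have B: "decomposes H B" "B \<inter> fst F = {}" "A = fst F \<union> B"
    using insert.prems by (auto simp: decomposes_def B_def disjoint_family_on_def)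
  have fin: "finite B" "finite (fst F)" using insert.prems B by auto
  obtain \<sigma> where \<sigma>: "\<sigma> permutes B" "(\<Prod>i\<in>B. w i (\<sigma> i)) = prod (component_weight w) H"
    using insert.IH[OF B(1) fin(1)] by blast
  obtain cs where cs: "distinct cs" "set cs = fst F"
      "prod_list (map2 w cs (rotate1 cs)) = component_weight w F"
    using component_to_cycle[OF F] .
  have q: "cycle_of_list cs permutes fst F" using cycle_permutes[of cs] cs by simp
  have "(\<Prod>i\<in>fst F. w i (cycle_of_list cs i)) = component_weight w F"
    using prod_cycle_of_list[OF cs(1), of w] cs by simp
  then have "(\<Prod>i\<in>A. w i ((cycle_of_list cs \<circ> \<sigma>) i)) = prod (component_weight w) (insert F H)"
    using prod_permutes_disjoint(2)[OF \<sigma>(1) q B(2) fin, of w] insert.hyps \<sigma>(2) B(3) by simp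
  then show ?case using prod_permutes_disjoint(1)[OF \<sigma>(1) q B(2) fin] B(3) by blast
qed

end

subsection \<open>Counting independent transversals\<close>

lemma avg_const:
  assumes "finite S" "\<And>v. v \<in> S \<Longrightarrow> card (V v) > 0"
  shows "avg S V (\<lambda>_. c) = c"
proof -
  have "(\<Prod>i\<in>S. real (card (V i))) \<noteq> 0" using assms by (auto simp: prod_zero_iff)
  then show ?thesis using assms(1) by (simp add: avg_def card_PiE)
qed

lemma avg_two_coordinates:
  assumes "finite S" "\<And>v. v \<in> S \<Longrightarrow> card (V v) > 0" "i \<in> S" "j \<in> S" "i \<noteq> j"
  shows "avg S V (\<lambda>x. g (x i) (x j))
    = (\<Sum>a\<in>V i. \<Sum>b\<in>V j. g a b) / (real (card (V i)) * real (card (V j)))"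
proof -
  define R where "R = S - {i, j}"
  have S: "S = insert j (insert i R)" "j \<notin> insert i R" "i \<notin> R" "finite R"
    using assms by (auto simp: R_def)
  have "avg S V (\<lambda>x. g (x i) (x j))
      = avg R V (\<lambda>_. (\<Sum>a\<in>V i. (\<Sum>b\<in>V j. g a b) / card (V j)) / card (V i))"
    using S assms(5) by (simp add: avg_insert)
  also have "\<dots> = (\<Sum>a\<in>V i. (\<Sum>b\<in>V j. g a b) / card (V j)) / card (V i)"
    using assms S by (intro avg_const) auto
  finally show ?thesis by (simp add: sum_divide_distrib[symmetric] mult.commute)
qed

section \<open>Edge counts, and transversals as choice functions\<close>

lemma edges_between_commute: "edges_between E A B = edges_between E B A"
  unfolding edges_between_def by (auto simp: insert_commute)

lemma edge_density_commute: "edge_density E A B = edge_density E B A"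
  unfolding edge_density_def by (simp add: edges_between_commute[of E A] mult.commute)

text \<open>As the two sets are disjoint, an unordered edge determines which endpoint lies in which
  set.\<close>

lemma card_edges_between:
  assumes "finite A" "finite B" "A \<inter> B = {}"
  shows "card (edges_between E A B) = card {(a, b) \<in> A \<times> B. {a, b} \<in> E}"
proof -
  have "edges_between E A B = (\<lambda>(a, b). {a, b}) ` {(a, b) \<in> A \<times> B. {a, b} \<in> E}"
    unfolding edges_between_def by auto
  moreover have "inj_on (\<lambda>(a, b). {a, b}) {(a, b) \<in> A \<times> B. {a, b} \<in> E}"
    using assms(3) by (auto simp: inj_on_def doubleton_eq_iff)
  ultimately show ?thesis by (simp add: card_image)
qed

lemma card_non_edges:
  assumes "finite A" "finite B" "A \<inter> B = {}"
  shows "real (card (edges_between E A B)) + real (card {(a, b) \<in> A \<times> B. {a, b} \<notin> E})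
    = real (card A) * real (card B)"
proof -
  have "card {(a, b) \<in> A \<times> B. {a, b} \<in> E} + card {(a, b) \<in> A \<times> B. {a, b} \<notin> E}
      = card ({(a, b) \<in> A \<times> B. {a, b} \<in> E} \<union> {(a, b) \<in> A \<times> B. {a, b} \<notin> E})"
    using assms by (intro card_Un_disjoint[symmetric])
      (auto intro: finite_subset[OF _ finite_cartesian_product[OF assms(1,2)]])
  also have "{(a, b) \<in> A \<times> B. {a, b} \<in> E} \<union> {(a, b) \<in> A \<times> B. {a, b} \<notin> E} = A \<times> B"
    by auto
  finally show ?thesis
    using card_edges_between[OF assms, of E]
    by (simp add: card_cartesian_product flip: of_nat_add of_nat_mult)
qed

text \<open>Choice functions replace sets, so that counting becomes summation over a product.
  Disjoint parts make the image meet \<open>V i\<close> only in \<open>x i\<close>; the condition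
  includes \<open>i = j\<close> because independence ranges over all \<open>u\<close> and
  \<open>v\<close>, equal ones included.\<close>

lemma bij_betw_independent_transversals:
  assumes "disjoint_family_on V {1..k}"
  shows "bij_betw (\<lambda>x. x ` {1..k})
    {x \<in> Pi\<^sub>E {1..k} V. \<forall>i\<in>{1..k}. \<forall>j\<in>{1..k}. {x i, x j} \<notin> E} (independent_transversals k V E)"
    (is "bij_betw ?f ?X ?T")
proof (rule bij_betw_imageI)
  have meet: "x ` {1..k} \<inter> V i = {x i}" if "x \<in> Pi\<^sub>E {1..k} V" "i \<in> {1..k}" for x i
  proof (intro equalityI subsetI)
    fix s assume s: "s \<in> x ` {1..k} \<inter> V i"
    then obtain j where j: "j \<in> {1..k}" "s = x j" by blast
    then have "s \<in> V j" using that(1) by (simp add: PiE_iff)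
    then have "j = i"
      using disjoint_family_onD[OF assms j(1) that(2)] s by blast
    then show "s \<in> {x i}" using j by simp
  qed (use that in \<open>auto simp: PiE_iff\<close>)
  show "inj_on ?f ?X"
  proof (rule inj_onI)
    fix x y assume x: "x \<in> ?X" and y: "y \<in> ?X" and eq: "?f x = ?f y"
    have "x i = y i" if "i \<in> {1..k}" for i
    proof -
      have "{x i} = {y i}" using meet[of x i] meet[of y i] x y eq that by simp
      then show ?thesis by simp
    qed
    then show "x = y" using x y by (intro PiE_ext[of x "{1..k}" V y]) auto
  qed
  show "?f ` ?X = ?T"
  proof (intro equalityI subsetI)
    fix S assume "S \<in> ?f ` ?X"
    then obtain x where x: "x \<in> ?X" "S = x ` {1..k}" by blast
    then have "\<forall>i\<in>{1..k}. card (S \<inter> V i) = 1" using meet[of x] by auto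
    moreover have "S \<subseteq> (\<Union>i\<in>{1..k}. V i)" using x by (auto simp: PiE_iff)
    ultimately show "S \<in> ?T" using x unfolding independent_transversals_def by auto
  next
    fix S assume "S \<in> ?T"
    then have S: "S \<subseteq> (\<Union>i\<in>{1..k}. V i)" "\<And>i. i \<in> {1..k} \<Longrightarrow> \<exists>s. S \<inter> V i = {s}"
        "\<And>u v. u \<in> S \<Longrightarrow> v \<in> S \<Longrightarrow> {u, v} \<notin> E"
      unfolding independent_transversals_def by (auto simp: card_1_singleton_iff)
    define x where "x = (\<lambda>i\<in>{1..k}. the_elem (S \<inter> V i))"
    have x: "S \<inter> V i = {x i}" if i: "i \<in> {1..k}" for i
    proof -
      obtain s where "S \<inter> V i = {s}" using S(2)[OF i] by blast
      moreover have "x i = the_elem (S \<inter> V i)" using i by (simp add: x_def)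
      ultimately show ?thesis by simp
    qed
    have xS: "x i \<in> S" "x i \<in> V i" if "i \<in> {1..k}" for i
      using x[OF that] by auto
    have "S = x ` {1..k}"
    proof (intro equalityI subsetI)
      fix s assume "s \<in> S"
      then obtain i where i: "i \<in> {1..k}" "s \<in> V i" using S(1) by blast
      then have "s = x i" using x[OF i(1)] \<open>s \<in> S\<close> by blast
      then show "s \<in> x ` {1..k}" using i(1) by blast
    qed (use xS in auto)
    moreover have "x \<in> ?X"
      using xS S(3) by (auto simp: PiE_iff x_def extensional_def)
    ultimately show "S \<in> ?f ` ?X" by blast
  qed
qed

text \<open>Only the non-edge conditions at the pairs \<open>(i, \<sigma> i)\<close> are kept. Their
  indicators use each coordinate at most twice, so \<open>avg_prod_le\<close> applies, and the mean
  square of an indicator is the density of non-edges.\<close>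

lemma card_independent_transversals_le:
  assumes "multipartite_graph k V E"
    and pos: "\<And>i. i \<in> {1..k} \<Longrightarrow> card (V i) > 0"
    and \<sigma>: "\<sigma> permutes {1..k}"
  shows "real (card (independent_transversals k V E)) \<le> (\<Prod>i=1..k. real (card (V i))) *
    (\<Prod>i=1..k. sqrt (if \<sigma> i = i then 1 else 1 - edge_density E (V i) (V (\<sigma> i))))"
proof -
  define N where "N = (\<Prod>i=1..k. real (card (V i)))"
  have N: "N > 0" unfolding N_def using pos by (intro prod_pos) auto
  have fin: "finite (V i)" "V i \<noteq> {}" if "i \<in> {1..k}" for i
    using pos[OF that] card_gt_0_iff by blast+
  have dis: "disjoint_family_on V {1..k}" using assms(1) by (simp add: multipartite_graph_def)
  define f where "f i x = (if \<sigma> i = i then 1 else of_bool ({x i, x (\<sigma> i)} \<notin> E) :: real)" for i x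
  define X where "X = {x \<in> Pi\<^sub>E {1..k} V. \<forall>i\<in>{1..k}. \<forall>j\<in>{1..k}. {x i, x j} \<notin> E}"
  have "card (independent_transversals k V E) = card X"
    unfolding X_def using bij_betw_same_card[OF bij_betw_independent_transversals[OF dis]] by metis
  also have "real (card X) = (\<Sum>x\<in>X. 1)" by simp
  also have "\<dots> \<le> (\<Sum>x\<in>X. \<Prod>i\<in>{1..k}. f i x)"
  proof (rule sum_mono)
    fix x assume x: "x \<in> X"
    have "f i x = 1" if "i \<in> {1..k}" for i
      using x that permutes_in_image[OF \<sigma>] by (auto simp: f_def X_def)
    then show "1 \<le> (\<Prod>i\<in>{1..k}. f i x)" by simp
  qed
  also have "\<dots> \<le> (\<Sum>x\<in>Pi\<^sub>E {1..k} V. \<Prod>i\<in>{1..k}. f i x)"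
    using fin by (intro sum_mono2 finite_PiE prod_nonneg) (auto simp: X_def f_def)
  also have "\<dots> = N * avg {1..k} V (\<lambda>x. \<Prod>i\<in>{1..k}. f i x)"
    unfolding avg_def N_def[symmetric] using N by simp
  also have "\<dots> \<le> N * (\<Prod>i\<in>{1..k}. sqrt (avg {1..k} V (\<lambda>x. (f i x)\<^sup>2)))"
  proof (intro mult_left_mono avg_prod_le[where T = "\<lambda>i. {i, \<sigma> i}"])
    fix v
    \<comment> \<open>Only the factors with index \<open>v\<close> and \<open>inv \<sigma> v\<close>
      can depend on the coordinate \<open>v\<close>.\<close>
    have "{e \<in> {1..k}. v \<in> {e, \<sigma> e}} \<subseteq> {v, inv \<sigma> v}"
      using permutes_inverses(2)[OF \<sigma>] by auto
    then have "card {e \<in> {1..k}. v \<in> {e, \<sigma> e}} \<le> card {v, inv \<sigma> v}" by (intro card_mono) auto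
    also have "\<dots> \<le> 2" by (simp add: card_insert_if)
    finally show "card {e \<in> {1..k}. v \<in> {e, \<sigma> e}} \<le> 2" .
  qed (use N fin pos in \<open>auto simp: f_def\<close>)
  also have "(\<Prod>i\<in>{1..k}. sqrt (avg {1..k} V (\<lambda>x. (f i x)\<^sup>2)))
      = (\<Prod>i=1..k. sqrt (if \<sigma> i = i then 1 else 1 - edge_density E (V i) (V (\<sigma> i))))"
  proof (intro prod.cong refl arg_cong[of _ _ sqrt])
    fix i assume i: "i \<in> {1..k}"
    then have \<sigma>i: "\<sigma> i \<in> {1..k}" using permutes_in_image[OF \<sigma>] by simp
    show "avg {1..k} V (\<lambda>x. (f i x)\<^sup>2) = (if \<sigma> i = i then 1 else 1 - edge_density E (V i) (V (\<sigma> i)))"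
    proof (cases "\<sigma> i = i")
      case True
      then show ?thesis using pos avg_const[of "{1..k}" V 1] by (simp add: f_def)
    next
      case False
      define A B where "A = V i" "B = V (\<sigma> i)"
      have AB: "finite A" "finite B" "A \<inter> B = {}" "card A > 0" "card B > 0"
        using fin pos i \<sigma>i False dis by (auto simp: A_B_def disjoint_family_on_def)
      have "avg {1..k} V (\<lambda>x. (f i x)\<^sup>2)
          = (\<Sum>a\<in>A. \<Sum>b\<in>B. of_bool ({a, b} \<notin> E)) / (real (card A) * real (card B))"
        using avg_two_coordinates[of "{1..k}" V i "\<sigma> i" "\<lambda>a b. of_bool ({a, b} \<notin> E)"] pos i \<sigma>i False
        by (simp add: f_def A_B_def of_bool_def if_distrib[of "\<lambda>x. x\<^sup>2"] cong: if_cong)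
      also have "(\<Sum>a\<in>A. \<Sum>b\<in>B. of_bool ({a, b} \<notin> E)) = (\<Sum>(a, b)\<in>A \<times> B. of_bool ({a, b} \<notin> E) :: real)"
        by (rule sum.cartesian_product)
      also have "\<dots> = real (card {(a, b) \<in> A \<times> B. {a, b} \<notin> E})"
      proof -
        have "{(a, b) \<in> A \<times> B. {a, b} \<notin> E} = (A \<times> B) \<inter> {z. {fst z, snd z} \<notin> E}" by auto
        then show ?thesis using AB by (simp add: case_prod_unfold sum_of_bool_eq)
      qed
      also have "\<dots> = real (card A) * real (card B) - real (card (edges_between E A B))"
        using card_non_edges[OF AB(1-3), of E] by linarith
      also have "\<dots> / (real (card A) * real (card B)) = 1 - edge_density E A B"
        using AB(4,5) by (auto simp: edge_density_def diff_divide_distrib)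
      finally show ?thesis using False by (simp add: A_B_def)
    qed
  qed
  finally show ?thesis unfolding N_def .
qed

text \<open>Near 0 the square root is only Hoelder continuous with exponent 1/2, so a density error
  of \<open>1 / n\<close> can grow to \<open>1 / sqrt n\<close>; this explains the order of
  \<open>error_term\<close>.\<close>

lemma abs_sqrt_diff_le:
  assumes "a \<ge> 0" "b \<ge> 0"
  shows "\<bar>sqrt a - sqrt b\<bar> \<le> sqrt \<bar>a - b\<bar>"
proof -
  have *: "sqrt y - sqrt x \<le> sqrt (y - x)" if "0 \<le> x" "x \<le> y" for x y
    using sqrt_add_le_add_sqrt[of x "y - x"] that by simp
  show ?thesis
    using *[of a b] *[of b a] assms by (cases "a \<le> b") (auto simp: abs_real_def)
qed

text \<open>With the costs \<open>- ln (p i j)\<close>, duality gives \<open>u\<close> and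
  \<open>v\<close>, which \<open>a i = exp (- (u i + v i) / 2)\<close> symmetrises. The dual
  constraint at \<open>(i, i)\<close> yields \<open>a i \<le> 1\<close>, and the equality of the two
  optimal values yields the last estimate.\<close>

lemma exists_vertex_weights:
  fixes p :: "'a \<Rightarrow> 'a \<Rightarrow> real"
  assumes "finite S"
    and sym: "\<And>i j. p i j = p j i"
    and diag: "\<And>i. p i i = 1"
    and nonneg: "\<And>i j. p i j \<ge> 0"
  obtains a \<sigma> where "\<And>i. i \<in> S \<Longrightarrow> 0 \<le> a i \<and> a i \<le> 1"
    and "\<And>i j. i \<in> S \<Longrightarrow> j \<in> S \<Longrightarrow> a i * a j \<le> p i j"
    and "\<sigma> permutes S"
    and "(\<Prod>i\<in>S. sqrt (p i (\<sigma> i))) \<le> (\<Prod>i\<in>S. a i)"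
proof (cases "\<forall>i\<in>S. \<forall>j\<in>S. p i j > 0")
  case False
  \<comment> \<open>A zero entry excludes logarithms. It lies off the diagonal, and the
    transposition of \<open>i\<close> and \<open>j\<close> then has weight 0, so that
    \<open>a = 0\<close> suffices.\<close>
  then obtain i j where ij: "i \<in> S" "j \<in> S" "p i j = 0"
    using nonneg by (metis less_eq_real_def)
  have "(\<Prod>l\<in>S. sqrt (p l (transpose i j l))) = 0"
    using ij assms(1) by (intro prod_zero bexI[of _ i]) auto
  then show ?thesis
    using ij nonneg by (intro that[of "\<lambda>_. 0" "transpose i j"] permutes_swap_id)
      (simp_all add: prod_nonneg)
next
  case True
  obtain \<sigma> u v where \<sigma>: "\<sigma> permutes S"
    and dual: "\<And>i j. i \<in> S \<Longrightarrow> j \<in> S \<Longrightarrow> - ln (p i j) \<le> u i + v j"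
    and val: "(\<Sum>i\<in>S. u i + v i) = (\<Sum>i\<in>S. - ln (p i (\<sigma> i)))"
    using assignment_duality[OF assms(1), of "\<lambda>i j. - ln (p i j)"] by blast
  define a where "a i = exp (- (u i + v i) / 2)" for i
  show ?thesis
  proof (rule that[OF _ _ \<sigma>])
    fix i assume "i \<in> S"
    then show "0 \<le> a i \<and> a i \<le> 1" using dual[of i i] by (simp add: a_def diag)
  next
    fix i j assume ij: "i \<in> S" "j \<in> S"
    have "a i * a j = exp (- (u i + v j + (u j + v i)) / 2)"
      by (simp add: a_def field_simps flip: exp_add)
    \<comment> \<open>Half the sum of the dual constraints at \<open>(i, j)\<close> and
      \<open>(j, i)\<close>, whose left-hand sides agree by the symmetry of
      \<open>p\<close>.\<close>
    also have "\<dots> \<le> exp (ln (p i j))"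
      using dual[OF ij] dual[OF ij(2,1)] sym[of j i] by simp
    finally show "a i * a j \<le> p i j" using True ij by simp
  next
    have "sqrt (p i (\<sigma> i)) = exp (- (- ln (p i (\<sigma> i))) / 2)" if "i \<in> S" for i
    proof -
      have "p i (\<sigma> i) > 0" using True that permutes_in_image[OF \<sigma>] by blast
      then show ?thesis
        by (intro real_sqrt_unique) (auto simp: power2_eq_square simp flip: exp_add)
    qed
    then have "(\<Prod>i\<in>S. sqrt (p i (\<sigma> i))) = exp (\<Sum>i\<in>S. - (- ln (p i (\<sigma> i))) / 2)"
      using assms(1) by (simp add: exp_sum)
    also have "(\<Sum>i\<in>S. - (- ln (p i (\<sigma> i))) / 2) = (\<Sum>i\<in>S. - (u i + v i) / 2)"
      using val by (simp only: sum_negf sum_divide_distrib[symmetric])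
    also have "exp \<dots> = (\<Prod>i\<in>S. a i)"
      using assms(1) by (simp add: exp_sum a_def)
    finally show "(\<Prod>i\<in>S. sqrt (p i (\<sigma> i))) \<le> (\<Prod>i\<in>S. a i)" by simp
  qed
qed

text \<open>The prescribed density of non-edges, made total: reading \<open>d\<close> at the ordered
  pair gives symmetry, and the default 1 makes the diagonal and all indices outside
  \<open>{1..k}\<close> neutral factors.\<close>

definition pair_density :: "nat \<Rightarrow> (nat \<Rightarrow> nat \<Rightarrow> real) \<Rightarrow> nat \<Rightarrow> nat \<Rightarrow> real" where
  "pair_density k d i j =
     (if i \<noteq> j \<and> i \<in> {1..k} \<and> j \<in> {1..k} then 1 - d (min i j) (max i j) else 1)"

lemma pair_density_sym: "pair_density k d i j = pair_density k d j i"
  by (simp add: pair_density_def min.commute max.commute)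

lemma pair_density_diag: "pair_density k d i i = 1"
  by (simp add: pair_density_def)

lemma zip_rotate1_distinct:
  assumes "distinct xs" "length xs \<ge> 2" "(a, b) \<in> set (zip xs (rotate1 xs))"
  shows "a \<noteq> b"
proof -
  obtain n where n: "n < length xs" "a = xs ! n" "b = rotate1 xs ! n"
    using assms(3) by (auto simp: set_zip)
  have "Suc n mod length xs \<noteq> n" "Suc n mod length xs < length xs"
    using n(1) assms(2) by (cases "Suc n = length xs"; auto)+
  then show ?thesis
    using n assms(1,2) nth_eq_iff_index_eq[OF assms(1), of n "Suc n mod length xs"]
    by (auto simp: nth_rotate1)
qed

text \<open>Neighbours on a cycle without repetition differ, so \<open>edge\<close> stores them in
  strictly increasing order. On such pairs inside \<open>{1..k}\<close>, \<open>pair_density\<close>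
  equals \<open>1 - d i j\<close>.\<close>

lemma component_edge:
  assumes "is_odd_cycle F \<or> is_double_edge F \<or> is_isolated_vertex F" "(i, j) \<in># snd F"
  shows "i < j" "i \<in> fst F" "j \<in> fst F"
proof -
  have "\<exists>a b. a \<noteq> b \<and> a \<in> fst F \<and> b \<in> fst F \<and> (i, j) = edge a b"
    using assms(1)
  proof (elim disjE)
    assume "is_odd_cycle F"
    then obtain vs where vs: "distinct vs" "length vs \<ge> 3"
        "F = (set vs, mset (map2 edge vs (rotate1 vs)))"
      unfolding is_odd_cycle_def by blast
    then have "(i, j) \<in> (\<lambda>(a, b). edge a b) ` set (zip vs (rotate1 vs))"
      using assms(2) by simp
    then obtain a b where ab: "(a, b) \<in> set (zip vs (rotate1 vs))" "(i, j) = edge a b"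
      by auto
    then show ?thesis
      using zip_rotate1_distinct[OF vs(1) _ ab(1)] vs set_zip_leftD[OF ab(1)] set_zip_rightD[OF ab(1)]
      by (intro exI[of _ a] exI[of _ b]) auto
  next
    assume "is_double_edge F"
    then show ?thesis using assms(2) unfolding is_double_edge_def by fastforce
  next
    assume "is_isolated_vertex F"
    then show ?thesis using assms(2) unfolding is_isolated_vertex_def by auto
  qed
  then show "i < j" "i \<in> fst F" "j \<in> fst F"
    by (auto simp: edge_def min_def max_def split: if_splits)
qed

lemma mem_odd_cycle_decompositions:
  "H \<in> odd_cycle_decompositions k \<longleftrightarrow> decomposes H {1..k}"
  by (simp add: odd_cycle_decompositions_def decomposes_def)

lemma decomposition_weight_eq:
  assumes "decomposes H {1..k}"
  shows "decomposition_weight d H = prod (component_weight (\<lambda>i j. sqrt (pair_density k d i j))) H"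
  unfolding decomposition_weight_def component_weight_def
proof (intro prod.cong refl arg_cong[of _ _ prod_mset] image_mset_cong)
  fix F e assume F: "F \<in> H" and e: "e \<in># snd F"
  obtain i j where ij: "e = (i, j)" by fastforce
  have "is_odd_cycle F \<or> is_double_edge F \<or> is_isolated_vertex F" "fst F \<subseteq> {1..k}"
    using assms F by (auto simp: decomposes_def)
  then have "i < j" "i \<in> {1..k}" "j \<in> {1..k}"
    using component_edge[of F i j] e ij by auto
  then show "(case e of (i, j) \<Rightarrow> sqrt (1 - d i j)) = (case e of (i, j) \<Rightarrow> sqrt (pair_density k d i j))"
    by (simp add: ij pair_density_def)
qed

text \<open>Non-edges between the sets \<open>A i\<close> of the given sizes create all the transversals counted here;
  the remaining non-edges are placed arbitrarily.\<close>

lemma exists_graph: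
  fixes n m :: "nat \<Rightarrow> nat" and d :: "nat \<Rightarrow> nat \<Rightarrow> real"
  assumes d: "\<And>i j. 1 \<le> i \<Longrightarrow> i < j \<Longrightarrow> j \<le> k \<Longrightarrow> d i j \<in> {0..1}"
    and n: "\<And>i. i \<in> {1..k} \<Longrightarrow> n i > 0"
    and mn: "\<And>i. i \<in> {1..k} \<Longrightarrow> m i \<le> n i"
    and m: "\<And>i j. 1 \<le> i \<Longrightarrow> i < j \<Longrightarrow> j \<le> k \<Longrightarrow>
      real (m i) * real (m j) \<le> (1 - d i j) * (real (n i) * real (n j))"
  obtains V :: "nat \<Rightarrow> nat set" and E where "multipartite_graph k V E"
    and "\<And>i. i \<in> {1..k} \<Longrightarrow> card (V i) = n i"
    and "has_edge_densities k d V E"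
    and "(\<Prod>i=1..k. m i) \<le> card (independent_transversals k V E)"
proof -
  \<comment> \<open>Encoding the index of the part in each vertex makes the parts disjoint, and
    \<open>B i r\<close> grows with \<open>r\<close>, so that \<open>A i\<close> lies in
    \<open>V i\<close>.\<close>
  define B where "B i r = (\<lambda>t. prod_encode (i, t)) ` {..<r}" for i r :: nat
  define V where "V i = B i (n i)" for i
  define A where "A i = B i (m i)" for i
  \<comment> \<open>The prescribed number of non-edges, rounded down. It is still at least
    \<open>m i * m j\<close>, an integer not exceeding the unrounded value.\<close>
  define c where "c i j = nat \<lfloor>(1 - d i j) * (real (n i) * real (n j))\<rfloor>" for i j
  have card_B: "card (B i r) = r" "finite (B i r)" for i r
    unfolding B_def by (auto simp: card_image inj_on_def prod_encode_eq)
  have disj: "B i r \<inter> B j s = {}" if "i \<noteq> j" for i j r s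
    using that by (auto simp: B_def prod_encode_eq)
  have dis: "disjoint_family_on V {1..k}"
    using disj by (auto simp: disjoint_family_on_def V_def)
  have AV: "A i \<subseteq> V i" if "i \<in> {1..k}" for i
    using mn[OF that] by (auto simp: A_def V_def B_def)
  have ex: "\<exists>X. A i \<times> A j \<subseteq> X \<and> X \<subseteq> V i \<times> V j \<and> card X = c i j" if ij: "1 \<le> i" "i < j" "j \<le> k" for i j
  proof -
    have dij: "d i j \<in> {0..1}" by (rule d[OF ij])
    have "m i * m j \<le> c i j"
      unfolding c_def using m[OF ij] by (intro le_nat_floor) simp
    then have "card (A i \<times> A j) \<le> c i j"
      by (simp add: A_def card_B card_cartesian_product)
    moreover have "(1 - d i j) * (real (n i) * real (n j)) \<le> 1 * (real (n i) * real (n j))"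
      using dij by (intro mult_right_mono) auto
    then have "nat \<lfloor>(1 - d i j) * (real (n i) * real (n j))\<rfloor> \<le> nat \<lfloor>real (n i * n j)\<rfloor>"
      by (intro nat_mono floor_mono) simp
    then have "c i j \<le> card (V i \<times> V j)"
      unfolding c_def V_def by (simp only: card_B card_cartesian_product floor_of_nat nat_int)
    moreover have "A i \<times> A j \<subseteq> V i \<times> V j" using AV[of i] AV[of j] ij by auto
    moreover have "finite (V i \<times> V j)" by (simp add: V_def card_B)
    ultimately show ?thesis using exists_subset_between by metis
  qed
  define X where "X i j = (SOME X. A i \<times> A j \<subseteq> X \<and> X \<subseteq> V i \<times> V j \<and> card X = c i j)" for i j
  have X: "A i \<times> A j \<subseteq> X i j" "X i j \<subseteq> V i \<times> V j" "card (X i j) = c i j"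
    if "1 \<le> i" "i < j" "j \<le> k" for i j
    using someI_ex[OF ex[OF that]] unfolding X_def by auto
  define E where "E = {{u, v} | i j u v. 1 \<le> i \<and> i < j \<and> j \<le> k \<and> (u, v) \<in> V i \<times> V j - X i j}"
  have V_eq: "i = j" if "u \<in> V i" "u \<in> V j" for i j u
  proof (rule ccontr)
    assume "i \<noteq> j"
    then have "V i \<inter> V j = {}" unfolding V_def by (rule disj)
    then show False using that by blast
  qed
  have edge_iff: "{u, v} \<in> E \<longleftrightarrow> (u, v) \<notin> X i j"
    if "1 \<le> i" "i < j" "j \<le> k" "u \<in> V i" "v \<in> V j" for i j u v
  proof
    assume "{u, v} \<in> E"
    then obtain i' j' u' v' where *: "{u, v} = {u', v'}" "i' < j'" "u' \<in> V i'" "v' \<in> V j'"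
        "(u', v') \<notin> X i' j'"
      unfolding E_def by blast
    from *(1) consider "u = u'" "v = v'" | "u = v'" "v = u'" by (auto simp: doubleton_eq_iff)
    then show "(u, v) \<notin> X i j"
    proof cases
      case 1
      then show ?thesis using V_eq[of u i i'] V_eq[of v j j'] * that by auto
    next
      case 2
      then show ?thesis using V_eq[of u i j'] V_eq[of v j i'] * that by auto
    qed
  next
    assume "(u, v) \<notin> X i j"
    then show "{u, v} \<in> E" using that unfolding E_def by blast
  qed
  have mp: "multipartite_graph k V E"
    unfolding multipartite_graph_def
  proof (intro conjI ballI)
    fix e assume "e \<in> E"
    then obtain i j u v where "e = {u, v}" "1 \<le> i" "i < j" "j \<le> k" "u \<in> V i" "v \<in> V j"
      unfolding E_def by blast
    then show "\<exists>i\<in>{1..k}. \<exists>j\<in>{1..k}. i \<noteq> j \<and> (\<exists>u\<in>V i. \<exists>v\<in>V j. e = {u, v})"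
      by (intro bexI[of _ i] bexI[of _ j] conjI bexI[of _ u] bexI[of _ v]) auto
  qed (use dis in \<open>simp_all add: V_def card_B\<close>)
  have dens: "has_edge_densities k d V E"
    unfolding has_edge_densities_def
  proof (intro allI impI)
    fix i j assume ij: "1 \<le> i \<and> i < j \<and> j \<le> k"
    define M where "M = real (n i) * real (n j)"
    have M: "M > 0" using n[of i] n[of j] ij by (simp add: M_def)
    have "{(a, b) \<in> V i \<times> V j. {a, b} \<notin> E} = X i j"
      using edge_iff X(2)[of i j] ij by blast
    then have "real (card (edges_between E (V i) (V j))) + real (c i j) = M"
      using card_non_edges[of "V i" "V j" E] disj[of i j] ij X(3)[of i j]
      by (simp add: V_def card_B M_def)
    then have "real (card (edges_between E (V i) (V j))) = M - real (c i j)"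
      by linarith
    then have "edge_density E (V i) (V j) = 1 - real (c i j) / M"
      using M by (simp add: edge_density_def V_def card_B M_def[symmetric] diff_divide_distrib)
    then have "edge_density E (V i) (V j) - d i j = ((1 - d i j) * M - real (c i j)) / M"
      using M by (simp add: field_simps)
    moreover have "(1 - d i j) * M \<ge> 0" using d[of i j] ij M by auto
    \<comment> \<open>Rounding down changes the count by less than 1, which matches the strict
      inequality in \<open>has_edge_densities\<close>.\<close>
    then have "\<bar>(1 - d i j) * M - real (c i j)\<bar> < 1"
      unfolding c_def M_def[symmetric] by linarith
    ultimately show "\<bar>edge_density E (V i) (V j) - d i j\<bar> < 1 / (real (card (V i)) * real (card (V j)))"
      using M by (simp add: V_def card_B M_def[symmetric] divide_less_cancel)
  qed
  have no_edge: "{u, v} \<notin> E" if "i \<in> {1..k}" "j \<in> {1..k}" "u \<in> A i" "v \<in> A j" "i = j \<longrightarrow> u = v" for i j u v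
  proof -
    have uv: "u \<in> V i" "v \<in> V j" using that AV by auto
    consider "i < j" | "j < i" | "i = j" by linarith
    then show ?thesis
    proof cases
      case 1
      then show ?thesis using edge_iff[of i j u v] X(1)[of i j] that uv by auto
    next
      case 2
      then have "{v, u} \<notin> E" using edge_iff[of j i v u] X(1)[of j i] that uv by auto
      then show ?thesis by (simp add: insert_commute)
    next
      case 3
      then have "u = v" using that by simp
      then show ?thesis
        using V_eq unfolding E_def by (auto simp: doubleton_eq_iff)
    qed
  qed
  have "Pi\<^sub>E {1..k} A \<subseteq> {x \<in> Pi\<^sub>E {1..k} V. \<forall>i\<in>{1..k}. \<forall>j\<in>{1..k}. {x i, x j} \<notin> E}"
  proof (intro subsetI CollectI conjI ballI)
    fix x assume x: "x \<in> Pi\<^sub>E {1..k} A"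
    then show "x \<in> Pi\<^sub>E {1..k} V" using PiE_mono[of "{1..k}" A V] AV by blast
    fix i j assume ij: "i \<in> {1..k}" "j \<in> {1..k}"
    show "{x i, x j} \<notin> E"
      by (rule no_edge[OF ij PiE_mem[OF x ij(1)] PiE_mem[OF x ij(2)]]) simp
  qed
  moreover have "finite {x \<in> Pi\<^sub>E {1..k} V. \<forall>i\<in>{1..k}. \<forall>j\<in>{1..k}. {x i, x j} \<notin> E}"
    by (rule finite_subset[of _ "Pi\<^sub>E {1..k} V"]) (auto intro!: finite_PiE simp: V_def card_B)
  ultimately have "card (Pi\<^sub>E {1..k} A)
      \<le> card {x \<in> Pi\<^sub>E {1..k} V. \<forall>i\<in>{1..k}. \<forall>j\<in>{1..k}. {x i, x j} \<notin> E}"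
    by (intro card_mono)
  also have "\<dots> = card (independent_transversals k V E)"
    by (rule bij_betw_same_card[OF bij_betw_independent_transversals[OF dis]])
  finally have "card (Pi\<^sub>E {1..k} A) \<le> card (independent_transversals k V E)" .
  moreover have "card (Pi\<^sub>E {1..k} A) = (\<Prod>i=1..k. m i)"
    by (simp add: card_PiE A_def card_B)
  ultimately show ?thesis using that mp dens by (simp add: V_def card_B)
qed

section \<open>Bounds on densities and the error term\<close>

lemma edge_density_bounds:
  assumes "finite A" "finite B" "A \<inter> B = {}"
  shows "edge_density E A B \<in> {0..1}"
proof -
  have "real (card (edges_between E A B)) \<le> real (card A) * real (card B)"
    using card_non_edges[OF assms, of E] by linarith
  then show ?thesis
    by (auto simp: edge_density_def divide_le_eq_1 zero_less_mult_iff)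
qed

text \<open>Covers both the passage from densities to their square roots and the rounding of set
  sizes, each of which costs at most \<open>1 / sqrt (n i)\<close> per factor.\<close>

definition error_term :: "nat \<Rightarrow> (nat \<Rightarrow> nat) \<Rightarrow> real" where
  "error_term k n = (\<Prod>i=1..k. real (n i)) * (\<Sum>i=1..k. 1 / sqrt (real (n i)))"

lemma error_term_smallo: "error_term k \<in> o[sizes_at_top k](\<lambda>n. \<Prod>i=1..k. real (n i))"
proof -
  have "((\<lambda>n. 1 / sqrt (real (n i))) \<longlongrightarrow> 0) (sizes_at_top k)" if "i \<in> {1..k}" for i
  proof -
    have "filterlim (\<lambda>n :: nat \<Rightarrow> nat. n i) at_top (sizes_at_top k)"
      unfolding sizes_at_top_def
      by (rule filterlim_mono[OF filterlim_filtercomap order_refl INF_lower[OF that]])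
    then have "filterlim (\<lambda>n. sqrt (real (n i))) at_top (sizes_at_top k)"
      by (intro filterlim_compose[OF sqrt_at_top] filterlim_compose[OF filterlim_real_sequentially])
    then show ?thesis
      by (intro tendsto_divide_0[OF tendsto_const] filterlim_at_top_imp_at_infinity)
  qed
  then have "((\<lambda>n. \<Sum>i=1..k. 1 / sqrt (real (n i))) \<longlongrightarrow> 0) (sizes_at_top k)"
    by (intro tendsto_null_sum)
  then have "(\<lambda>n. \<Sum>i=1..k. 1 / sqrt (real (n i))) \<in> o[sizes_at_top k](\<lambda>_. 1)"
    by (intro smalloI_tendsto) auto
  then have "error_term k \<in> o[sizes_at_top k](\<lambda>n. (\<Prod>i=1..k. real (n i)) * 1)"
    unfolding error_term_def[abs_def] by (intro landau_o.big_small_mult landau_o.big_refl)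
  then show ?thesis by simp
qed

lemma pair_density_bounds:
  assumes "\<And>i j. 1 \<le> i \<Longrightarrow> i < j \<Longrightarrow> j \<le> k \<Longrightarrow> d i j \<in> {0..1}"
  shows "pair_density k d i j \<in> {0..1}"
proof (cases "i \<noteq> j \<and> i \<in> {1..k} \<and> j \<in> {1..k}")
  case True
  then have "d (min i j) (max i j) \<in> {0..1}" by (intro assms) auto
  then show ?thesis using True by (auto simp: pair_density_def)
qed (auto simp: pair_density_def)

section \<open>Upper and lower bound with an explicit error\<close>

lemma inverse_le_inverse_sqrt:
  assumes "n > 0"
  shows "1 / real n \<le> 1 / sqrt (real n)"
proof -
  have "sqrt (real n) \<le> real n" using assms by (intro real_le_lsqrt) (auto simp: power2_eq_square)
  then show ?thesis using assms by (intro divide_left_mono) auto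
qed

text \<open>A minimising decomposition yields a permutation of the same weight, to which the
  counting bound applies. The true densities deviate from the prescribed ones by rounding only, so
  the error is explicit and the estimate holds for all sizes.\<close>

lemma card_le_transversal_bound:
  assumes k: "k \<ge> 2"
    and d: "\<And>i j. 1 \<le> i \<Longrightarrow> i < j \<Longrightarrow> j \<le> k \<Longrightarrow> d i j \<in> {0..1}"
    and mp: "multipartite_graph k V E" and dens: "has_edge_densities k d V E"
  shows "real (card (independent_transversals k V E))
    \<le> transversal_bound k d (\<lambda>i. card (V i)) + error_term k (\<lambda>i. card (V i))"
proof -
  define n where "n i = card (V i)" for i
  define N where "N = (\<Prod>i=1..k. real (n i))"
  have N: "N \<ge> 0" by (simp add: N_def prod_nonneg)
  have dens': "\<bar>edge_density E (V i) (V j) - (1 - pair_density k d i j)\<bar> < 1 / (real (n i) * real (n j))"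
    if "i \<in> {1..k}" "j \<in> {1..k}" "i \<noteq> j" for i j
  proof (cases "i < j")
    case True
    then have "\<bar>edge_density E (V i) (V j) - d i j\<bar> < 1 / (real (n i) * real (n j))"
      using dens that unfolding has_edge_densities_def n_def by simp
    then show ?thesis using True that by (simp add: pair_density_def)
  next
    case False
    then have "\<bar>edge_density E (V j) (V i) - d j i\<bar> < 1 / (real (n j) * real (n i))"
      using dens that unfolding has_edge_densities_def n_def by simp
    then show ?thesis
      using False that
      by (simp add: pair_density_def edge_density_commute[of E "V i"] mult.commute)
  qed
  \<comment> \<open>If a part is empty, the tolerance is \<open>1 / 0 = 0\<close> and the strict
    inequality fails. The second index exists since \<open>k \<ge> 2\<close>.\<close>
  have pos: "n i > 0" if "i \<in> {1..k}" for i
  proof -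
    obtain j where "j \<in> {1..k}" "i \<noteq> j"
      using k by (metis One_nat_def Suc_1 atLeastAtMost_iff le_refl n_not_Suc_n nat_le_linear not_less_eq_eq)
    from dens'[OF that this] show ?thesis by (cases "n i = 0") auto
  qed
  have "transversal_bound k d n \<in> (\<lambda>H. N * decomposition_weight d H) ` odd_cycle_decompositions k"
    unfolding transversal_bound_def N_def
    using finite_odd_cycle_decompositions odd_cycle_decompositions_nonempty
    by (intro Min_in finite_imageI) auto
  then obtain H where H: "H \<in> odd_cycle_decompositions k"
      "transversal_bound k d n = N * decomposition_weight d H"
    by blast
  define w where "w i j = sqrt (pair_density k d i j)" for i j
  have w: "\<And>i j. w i j = w j i" "\<And>i. w i i = 1" "\<And>i j. w i j \<ge> 0"
    using pair_density_sym[of k d] pair_density_diag[of k d] pair_density_bounds[of k d, OF d]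
    by (auto simp: w_def)
  obtain \<sigma> where \<sigma>: "\<sigma> permutes {1..k}"
      "(\<Prod>i=1..k. w i (\<sigma> i)) = decomposition_weight d H"
    using decomposition_to_permutation[of w, OF w, of H "{1..k}"] H(1) decomposition_weight_eq[of H k d]
    unfolding mem_odd_cycle_decompositions w_def[abs_def] by auto
  define q where "q i = (if \<sigma> i = i then 1 else 1 - edge_density E (V i) (V (\<sigma> i)))" for i
  have q: "q i \<in> {0..1}" "\<bar>sqrt (q i) - w i (\<sigma> i)\<bar> \<le> 1 / sqrt (real (n i))" if i: "i \<in> {1..k}" for i
  proof -
    have \<sigma>i: "\<sigma> i \<in> {1..k}" using permutes_in_image[OF \<sigma>(1)] i by simp
    have "q i \<in> {0..1} \<and> \<bar>sqrt (q i) - w i (\<sigma> i)\<bar> \<le> 1 / sqrt (real (n i))"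
    proof (cases "\<sigma> i = i")
      case True
      then show ?thesis by (simp add: q_def w)
    next
      case False
      have "finite (V i)" "finite (V (\<sigma> i))" "V i \<inter> V (\<sigma> i) = {}"
        using mp i \<sigma>i False by (auto simp: multipartite_graph_def disjoint_family_on_def)
      then have q01: "q i \<in> {0..1}"
        using edge_density_bounds[of "V i" "V (\<sigma> i)" E] False by (auto simp: q_def)
      have "\<bar>sqrt (q i) - w i (\<sigma> i)\<bar> \<le> sqrt \<bar>q i - pair_density k d i (\<sigma> i)\<bar>"
        using q01 pair_density_bounds[of k d, OF d, of i "\<sigma> i"]
        unfolding w_def by (intro abs_sqrt_diff_le) auto
      also have "\<bar>q i - pair_density k d i (\<sigma> i)\<bar> \<le> 1 / (real (n i) * real (n (\<sigma> i)))"
        using dens'[OF i \<sigma>i] False by (auto simp: q_def)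
      also have "\<dots> \<le> 1 / real (n i)"
        using pos[OF i] pos[OF \<sigma>i] by (intro divide_left_mono) (auto simp: mult_le_cancel_left1)
      finally show ?thesis using q01 by (simp add: real_sqrt_divide)
    qed
    then show "q i \<in> {0..1}" "\<bar>sqrt (q i) - w i (\<sigma> i)\<bar> \<le> 1 / sqrt (real (n i))" by auto
  qed
  \<comment> \<open>Telescoping: for factors of norm at most 1, two products differ by at most the
    sum of the differences of their factors.\<close>
  have "norm ((\<Prod>i=1..k. sqrt (q i)) - (\<Prod>i=1..k. w i (\<sigma> i)))
      \<le> (\<Sum>i=1..k. norm (sqrt (q i) - w i (\<sigma> i)))"
    using q(1) pair_density_bounds[of k d, OF d] w(3) by (intro norm_prod_diff) (auto simp: w_def)
  also have "\<dots> \<le> (\<Sum>i=1..k. 1 / sqrt (real (n i)))"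
    using q(2) by (intro sum_mono) auto
  finally have "(\<Prod>i=1..k. sqrt (q i)) \<le> decomposition_weight d H + (\<Sum>i=1..k. 1 / sqrt (real (n i)))"
    using \<sigma>(2) by simp
  then have "N * (\<Prod>i=1..k. sqrt (q i))
      \<le> N * (decomposition_weight d H + (\<Sum>i=1..k. 1 / sqrt (real (n i))))"
    using N by (rule mult_left_mono)
  moreover have "real (card (independent_transversals k V E)) \<le> N * (\<Prod>i=1..k. sqrt (q i))"
    unfolding N_def q_def n_def using pos
    by (intro card_independent_transversals_le[OF mp _ \<sigma>(1)]) (simp add: n_def)
  ultimately show ?thesis
    using H(2) by (simp add: error_term_def N_def n_def[abs_def] distrib_left)
qed

text \<open>The weights from \<open>exists_vertex_weights\<close> become set sizes
  \<open>m i\<close>, rounded down from \<open>a i * n i\<close>. The transversals inside these sets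
  number about \<open>\<Prod>i. a i\<close> times the product of all sizes, and \<sigma> supplies a
  decomposition that weighs no more than \<open>\<Prod>i. a i\<close>.\<close>

lemma exists_extremal_graph:
  assumes d: "\<And>i j. 1 \<le> i \<Longrightarrow> i < j \<Longrightarrow> j \<le> k \<Longrightarrow> d i j \<in> {0..1}"
    and n: "\<And>i. i \<in> {1..k} \<Longrightarrow> n i > 0"
  shows "\<exists>(V :: nat \<Rightarrow> nat set) E. multipartite_graph k V E \<and> (\<forall>i\<in>{1..k}. card (V i) = n i) \<and>
    has_edge_densities k d V E \<and>
    transversal_bound k d n - error_term k n \<le> real (card (independent_transversals k V E))"
proof -
  define p where "p = pair_density k d"
  define N where "N = (\<Prod>i=1..k. real (n i))"
  have N: "N \<ge> 0" by (simp add: N_def prod_nonneg)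
  have p: "\<And>i j. p i j = p j i" "\<And>i. p i i = 1" "\<And>i j. p i j \<ge> 0"
    using pair_density_sym[of k d] pair_density_diag[of k d] pair_density_bounds[of k d, OF d]
    by (auto simp: p_def)
  obtain a \<sigma> where a: "\<And>i. i \<in> {1..k} \<Longrightarrow> 0 \<le> a i \<and> a i \<le> 1"
      "\<And>i j. i \<in> {1..k} \<Longrightarrow> j \<in> {1..k} \<Longrightarrow> a i * a j \<le> p i j"
      and \<sigma>: "\<sigma> permutes {1..k}" "(\<Prod>i=1..k. sqrt (p i (\<sigma> i))) \<le> (\<Prod>i=1..k. a i)"
    using exists_vertex_weights[of "{1..k}" p] p by blast
  \<comment> \<open>Rounding down keeps \<open>m i * m j\<close> within the prescribed number of
    non-edges; rounding up could exceed it.\<close>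
  define m where "m i = nat \<lfloor>a i * real (n i)\<rfloor>" for i
  have m: "real (m i) \<le> a i * real (n i)" "a i * real (n i) \<le> real (m i) + 1" if "i \<in> {1..k}" for i
  proof -
    have "a i * real (n i) \<ge> 0" using a(1)[OF that] by simp
    then show "real (m i) \<le> a i * real (n i)" "a i * real (n i) \<le> real (m i) + 1"
      unfolding m_def by linarith+
  qed
  have mn: "m i \<le> n i" if "i \<in> {1..k}" for i
  proof -
    have "a i * real (n i) \<le> 1 * real (n i)" using a(1)[OF that] by (intro mult_right_mono) auto
    then show ?thesis using m(1)[OF that] by simp
  qed
  have mm: "real (m i) * real (m j) \<le> (1 - d i j) * (real (n i) * real (n j))"
    if ij: "1 \<le> i" "i < j" "j \<le> k" for i j
  proof -
    have "real (m i) * real (m j) \<le> (a i * real (n i)) * (a j * real (n j))"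
      using m(1)[of i] m(1)[of j] a(1)[of i] ij by (intro mult_mono) auto
    also have "\<dots> = a i * a j * (real (n i) * real (n j))" by simp
    also have "\<dots> \<le> p i j * (real (n i) * real (n j))"
      using a(2)[of i j] ij by (intro mult_right_mono) auto
    also have "p i j = 1 - d i j" using ij by (simp add: p_def pair_density_def)
    finally show ?thesis .
  qed
  obtain V :: "nat \<Rightarrow> nat set" and E where VE: "multipartite_graph k V E"
      "\<And>i. i \<in> {1..k} \<Longrightarrow> card (V i) = n i" "has_edge_densities k d V E"
      "(\<Prod>i=1..k. m i) \<le> card (independent_transversals k V E)"
    using exists_graph[of k d n m] d n mn mm by blast
  define w where "w i j = sqrt (p i j)" for i j
  have w: "\<And>i j. w i j = w j i" "\<And>i. w i i = 1" "\<And>i j. w i j \<ge> 0"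
    using p by (auto simp: w_def)
  obtain H where H: "decomposes H {1..k}" "prod (component_weight w) H \<le> (\<Prod>i=1..k. w i (\<sigma> i))"
    using permutation_to_decomposition[of w, OF w \<sigma>(1)] by auto
  have "transversal_bound k d n \<le> N * decomposition_weight d H"
    unfolding transversal_bound_def N_def
    using H(1) finite_odd_cycle_decompositions by (intro Min_le) (auto simp: mem_odd_cycle_decompositions)
  also have "decomposition_weight d H = prod (component_weight w) H"
    using decomposition_weight_eq[OF H(1), of d] by (simp add: w_def[abs_def] p_def)
  also have "N * \<dots> \<le> N * (\<Prod>i=1..k. a i)"
    using H(2) \<sigma>(2) N by (intro mult_left_mono) (auto simp: w_def)
  also have "(\<Prod>i=1..k. a i) \<le> (\<Prod>i=1..k. real (m i) / real (n i)) + (\<Sum>i=1..k. 1 / sqrt (real (n i)))"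
  proof -
    have "norm ((\<Prod>i=1..k. a i) - (\<Prod>i=1..k. real (m i) / real (n i)))
        \<le> (\<Sum>i=1..k. norm (a i - real (m i) / real (n i)))"
      using a(1) mn n by (intro norm_prod_diff) (auto simp: divide_le_eq_1)
    also have "\<dots> \<le> (\<Sum>i=1..k. 1 / sqrt (real (n i)))"
    proof (rule sum_mono)
      fix i assume i: "i \<in> {1..k}"
      have "a i - real (m i) / real (n i) = (a i * real (n i) - real (m i)) / real (n i)"
        using n[OF i] by (simp add: field_simps)
      also have "norm \<dots> \<le> 1 / real (n i)"
        using m[OF i] n[OF i] by (auto simp: divide_right_mono)
      finally show "norm (a i - real (m i) / real (n i)) \<le> 1 / sqrt (real (n i))"
        using inverse_le_inverse_sqrt[OF n[OF i]] by linarith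
    qed
    finally show ?thesis by simp
  qed
  also have "N * ((\<Prod>i=1..k. real (m i) / real (n i)) + (\<Sum>i=1..k. 1 / sqrt (real (n i))))
      = real (\<Prod>i=1..k. m i) + error_term k n"
  proof -
    have "N * (\<Prod>i=1..k. real (m i) / real (n i)) = (\<Prod>i=1..k. real (n i) * (real (m i) / real (n i)))"
      unfolding N_def by (rule prod.distrib[symmetric])
    also have "\<dots> = (\<Prod>i=1..k. real (m i))"
      using n by (intro prod.cong refl) (auto simp: less_imp_neq)
    finally show ?thesis by (simp add: distrib_left error_term_def N_def)
  qed
  finally have "transversal_bound k d n \<le> real (\<Prod>i=1..k. m i) + error_term k n"
    using N by (simp add: mult_left_mono)
  then show ?thesis
    using VE by (intro exI[of _ V] exI[of _ E]) (auto simp flip: of_nat_prod)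
qed

theorem theorem1p3:
  fixes k :: nat and d :: "nat \<Rightarrow> nat \<Rightarrow> real"
  assumes "k \<ge> 2"
    and "\<And>i j. 1 \<le> i \<Longrightarrow> i < j \<Longrightarrow> j \<le> k \<Longrightarrow> d i j = d j i \<and> d i j \<in> {0..1}"
  shows
    "(\<exists>r \<in> o[sizes_at_top k](\<lambda>n. \<Prod>i=1..k. real (n i)).
        \<forall>(V :: nat \<Rightarrow> 'a set) E.
          multipartite_graph k V E \<and> has_edge_densities k d V E \<longrightarrow>
          real (card (independent_transversals k V E))
            \<le> transversal_bound k d (\<lambda>i. card (V i)) + r (\<lambda>i. card (V i))) \<and>
     (\<exists>r \<in> o[sizes_at_top k](\<lambda>n. \<Prod>i=1..k. real (n i)).
        \<forall>n. (\<forall>i\<in>{1..k}. n i > 0) \<longrightarrow>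
          (\<exists>(V :: nat \<Rightarrow> nat set) E.
             multipartite_graph k V E \<and> (\<forall>i\<in>{1..k}. card (V i) = n i) \<and>
             has_edge_densities k d V E \<and>
             real (card (independent_transversals k V E)) = transversal_bound k d n + r n))"
proof (rule conjI)
  have d: "d i j \<in> {0..1}" if "1 \<le> i" "i < j" "j \<le> k" for i j
    using assms(2)[OF that] by blast
  show "\<exists>r \<in> o[sizes_at_top k](\<lambda>n. \<Prod>i=1..k. real (n i)).
      \<forall>(V :: nat \<Rightarrow> 'a set) E.
        multipartite_graph k V E \<and> has_edge_densities k d V E \<longrightarrow>
        real (card (independent_transversals k V E))
          \<le> transversal_bound k d (\<lambda>i. card (V i)) + r (\<lambda>i. card (V i))"
    using card_le_transversal_bound[of k d, OF assms(1) d] error_term_smallo by blast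
  define good where "good n V E \<longleftrightarrow> multipartite_graph k V E \<and>
      (\<forall>i\<in>{1..k}. card (V i) = n i) \<and> has_edge_densities k d V E \<and>
      transversal_bound k d n - error_term k n \<le> real (card (independent_transversals k V E))"
    for n and V :: "nat \<Rightarrow> nat set" and E
  \<comment> \<open>One graph is selected for each size vector, since \<open>r\<close> has to be a
    function of the sizes alone.\<close>
  have "\<forall>n. \<exists>V E. (\<forall>i\<in>{1..k}. n i > 0) \<longrightarrow> good n V E"
    using exists_extremal_graph[of k d, OF d] unfolding good_def by blast
  then obtain V E where VE: "\<And>n. (\<forall>i\<in>{1..k}. n i > 0) \<Longrightarrow> good n (V n) (E n)"
    by metis
  \<comment> \<open>The exact discrepancy of the selected graph, set to 0 where some part would be
    empty.\<close>
  define r where "r n = (if \<forall>i\<in>{1..k}. n i > 0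
      then real (card (independent_transversals k (V n) (E n))) - transversal_bound k d n else 0)" for n
  have "norm (r n) \<le> 1 * norm (error_term k n)" for n
  proof (cases "\<forall>i\<in>{1..k}. n i > 0")
    case True
    note g = VE[OF True, unfolded good_def]
    \<comment> \<open>\<open>good\<close> bounds \<open>r n\<close> from below, and the general
      upper bound, applied to the selected graph, bounds it from above. The cardinalities are known
      to agree with \<open>n\<close> only on \<open>{1..k}\<close>, which is all that these two
      functions inspect.\<close>
    have "transversal_bound k d (\<lambda>i. card (V n i)) = transversal_bound k d n"
        "error_term k (\<lambda>i. card (V n i)) = error_term k n"
      using g unfolding transversal_bound_def error_term_def by simp_all
    then have "\<bar>r n\<bar> \<le> error_term k n"
      using g card_le_transversal_bound[of k d, OF assms(1) d, of "V n" "E n"] True by (auto simp: r_def)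
    then show ?thesis by simp
  qed (auto simp: r_def)
  then have "r \<in> O[sizes_at_top k](error_term k)"
    by (intro bigoI[of _ 1] always_eventually) blast
  then have "r \<in> o[sizes_at_top k](\<lambda>n. \<Prod>i=1..k. real (n i))"
    using error_term_smallo by (rule landau_o.big_small_trans)
  moreover have "\<exists>(V :: nat \<Rightarrow> nat set) E. multipartite_graph k V E \<and>
      (\<forall>i\<in>{1..k}. card (V i) = n i) \<and> has_edge_densities k d V E \<and>
      real (card (independent_transversals k V E)) = transversal_bound k d n + r n"
    if "\<forall>i\<in>{1..k}. n i > 0" for n
    using VE[OF that] that unfolding good_def
    by (intro exI[of _ "V n"] exI[of _ "E n"]) (simp add: r_def)
  ultimately show "\<exists>r \<in> o[sizes_at_top k](\<lambda>n. \<Prod>i=1..k. real (n i)).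
      \<forall>n. (\<forall>i\<in>{1..k}. n i > 0) \<longrightarrow>
        (\<exists>(V :: nat \<Rightarrow> nat set) E.
           multipartite_graph k V E \<and> (\<forall>i\<in>{1..k}. card (V i) = n i) \<and>
           has_edge_densities k d V E \<and>
           real (card (independent_transversals k V E)) = transversal_bound k d n + r n)"
    by blast
qed

end
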